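(* Let $\mathbb T$ be the theory of bounded distributive lattices and let $A$ be a quasi-coherent $\mathbb I$-algebra. Then the following are equivalent: (1) the polynomial $\mathbb I$-algebra $A[\mathsf j]$ is quasi-coherent; (2) $A$ satisfies the generalised Phoa principle.
   Context: We work in intensional type theory with function extensionality. $\mathbb I$ is a bounded distributive lattice; an $\mathbb I$-algebra is a bounded distributive lattice $A$ with a homomorphism $\mathbb I\to A$. $\operatorname{Spec}A:=\mathbb I\text{-}\mathbf{Alg}(A,\mathbb I)$; $\mathcal O X:=\mathbb I^X$ with pointwise operations. $A$ is quasi-coherent if $\iota_A:A\to\mathcal O\operatorname{Spec}A$, $a\mapsto(x\mapsto x(a))$, is an isomorphism of $\mathbb I$-algebras. $A[\mathsf j]$ is the free $\mathbb I$-algebra over $A$ on one generator. $A$ satisfies the generalised Phoa principle if for every $\alpha:\mathbb I\to A$ and $i:\mathbb I$, $\alpha(i)=\alpha(0)\vee(i\wedge\alpha(1))$. *)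

theory Defs
  imports Main
begin

text \<open>
  HOL has full (classical) function spaces, so a direct reading of the synthetic notions
  below with HOL types in place of types would only speak about a degenerate model: there
  the generalised Phoa principle forces the algebra to be trivial.  The statements of type
  theory are therefore interpreted in an arbitrary category with finite limits and
  exponentials.  Sets (in the sense of types with unique identity proofs) in a fixed context
  of intensional type theory with function extensionality, with functions up to
  propositional equality as arrows, form such a category.  A variable of type \<open>X\<close> is read as
  a generalised element, i.e. an arrow \<open>\<Gamma> \<rightarrow> X\<close> from an arbitrary stage \<open>\<Gamma>\<close>, and a function
  \<open>X \<rightarrow> Y\<close> depending on such variables as a generalised element of the exponential.  Since
  the category is arbitrary, parameters of the context need not be carried along.
\<close>

record ('o, 'm) ccat =
  Obj :: "'o set"
  Arr :: "'m set"
  Dom :: "'m \<Rightarrow> 'o"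
  Cod :: "'m \<Rightarrow> 'o"
  ident :: "'o \<Rightarrow> 'm"
  comp :: "'m \<Rightarrow> 'm \<Rightarrow> 'm"  (infixr "\<bullet>\<index>" 70)
  one :: 'o
  bang :: "'o \<Rightarrow> 'm"
  prod_obj :: "'o \<Rightarrow> 'o \<Rightarrow> 'o"
  proj1 :: "'o \<Rightarrow> 'o \<Rightarrow> 'm"
  proj2 :: "'o \<Rightarrow> 'o \<Rightarrow> 'm"
  tuple :: "'m \<Rightarrow> 'm \<Rightarrow> 'm"
  exp_obj :: "'o \<Rightarrow> 'o \<Rightarrow> 'o"  \<comment> \<open>\<open>exp_obj C X Y\<close> is the object of functions from \<open>X\<close> to \<open>Y\<close>\<close>
  ev :: "'o \<Rightarrow> 'o \<Rightarrow> 'm"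
  curry_arr :: "'o \<Rightarrow> 'o \<Rightarrow> 'm \<Rightarrow> 'm"  \<comment> \<open>\<open>curry_arr C \<Gamma> X f : \<Gamma> \<rightarrow> Y\<^sup>X\<close> for \<open>f : \<Gamma> \<times> X \<rightarrow> Y\<close>\<close>

definition hom :: "('o, 'm) ccat \<Rightarrow> 'o \<Rightarrow> 'o \<Rightarrow> 'm set" where
  "hom C X Y = {f \<in> Arr C. Dom C f = X \<and> Cod C f = Y}"

definition app :: "('o, 'm) ccat \<Rightarrow> 'o \<Rightarrow> 'o \<Rightarrow> 'm \<Rightarrow> 'm \<Rightarrow> 'm" where
  "app C X Y f a = ev C X Y \<bullet>\<^bsub>C\<^esub> tuple C f a"

locale small_category =
  fixes C :: "('o, 'm) ccat" (structure)
  assumes dom_obj: "f \<in> Arr C \<Longrightarrow> Dom C f \<in> Obj C"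
    and cod_obj: "f \<in> Arr C \<Longrightarrow> Cod C f \<in> Obj C"
    and ident_hom: "X \<in> Obj C \<Longrightarrow> ident C X \<in> hom C X X"
    and comp_hom: "f \<in> hom C X Y \<Longrightarrow> g \<in> hom C Y Z \<Longrightarrow> g \<bullet> f \<in> hom C X Z"
    and ident_left: "f \<in> hom C X Y \<Longrightarrow> ident C Y \<bullet> f = f"
    and ident_right: "f \<in> hom C X Y \<Longrightarrow> f \<bullet> ident C X = f"
    and comp_assoc: "f \<in> hom C W X \<Longrightarrow> g \<in> hom C X Y \<Longrightarrow> h \<in> hom C Y Z
                      \<Longrightarrow> (h \<bullet> g) \<bullet> f = h \<bullet> (g \<bullet> f)"

locale fin_complete_ccc = small_category +
  assumes one_obj: "one C \<in> Obj C"
    and bang_hom: "X \<in> Obj C \<Longrightarrow> bang C X \<in> hom C X (one C)"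
    and bang_unique: "f \<in> hom C X (one C) \<Longrightarrow> f = bang C X"
    and prod_obj: "X \<in> Obj C \<Longrightarrow> Y \<in> Obj C \<Longrightarrow> prod_obj C X Y \<in> Obj C"
    and proj1_hom: "X \<in> Obj C \<Longrightarrow> Y \<in> Obj C \<Longrightarrow> proj1 C X Y \<in> hom C (prod_obj C X Y) X"
    and proj2_hom: "X \<in> Obj C \<Longrightarrow> Y \<in> Obj C \<Longrightarrow> proj2 C X Y \<in> hom C (prod_obj C X Y) Y"
    and tuple_hom: "f \<in> hom C W X \<Longrightarrow> g \<in> hom C W Y \<Longrightarrow> tuple C f g \<in> hom C W (prod_obj C X Y)"
    and proj1_tuple: "f \<in> hom C W X \<Longrightarrow> g \<in> hom C W Y \<Longrightarrow> proj1 C X Y \<bullet> tuple C f g = f"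
    and proj2_tuple: "f \<in> hom C W X \<Longrightarrow> g \<in> hom C W Y \<Longrightarrow> proj2 C X Y \<bullet> tuple C f g = g"
    and tuple_unique: "X \<in> Obj C \<Longrightarrow> Y \<in> Obj C \<Longrightarrow> h \<in> hom C W (prod_obj C X Y)
                        \<Longrightarrow> tuple C (proj1 C X Y \<bullet> h) (proj2 C X Y \<bullet> h) = h"
    and equalizers: "f \<in> hom C X Y \<Longrightarrow> g \<in> hom C X Y
          \<Longrightarrow> \<exists>E\<in>Obj C. \<exists>e\<in>hom C E X. f \<bullet> e = g \<bullet> e \<and>
                (\<forall>W\<in>Obj C. \<forall>h\<in>hom C W X. f \<bullet> h = g \<bullet> h \<longrightarrow> (\<exists>!k. k \<in> hom C W E \<and> e \<bullet> k = h))"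
    and exp_obj: "X \<in> Obj C \<Longrightarrow> Y \<in> Obj C \<Longrightarrow> exp_obj C X Y \<in> Obj C"
    and ev_hom: "X \<in> Obj C \<Longrightarrow> Y \<in> Obj C \<Longrightarrow> ev C X Y \<in> hom C (prod_obj C (exp_obj C X Y) X) Y"
    and curry_hom: "W \<in> Obj C \<Longrightarrow> X \<in> Obj C \<Longrightarrow> f \<in> hom C (prod_obj C W X) Y
          \<Longrightarrow> curry_arr C W X f \<in> hom C W (exp_obj C X Y)"
    and curry_app: "W \<in> Obj C \<Longrightarrow> X \<in> Obj C \<Longrightarrow> f \<in> hom C (prod_obj C W X) Y
          \<Longrightarrow> app C X Y (curry_arr C W X f \<bullet> proj1 C W X) (proj2 C W X) = f"
    and curry_unique: "W \<in> Obj C \<Longrightarrow> X \<in> Obj C \<Longrightarrow> Y \<in> Obj C \<Longrightarrow> g \<in> hom C W (exp_obj C X Y)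
          \<Longrightarrow> curry_arr C W X (app C X Y (g \<bullet> proj1 C W X) (proj2 C W X)) = g"

record ('o, 'm) bdl =
  car :: 'o
  join :: 'm
  meet :: 'm
  bot :: 'm
  top :: 'm

record ('o, 'm) alg = "('o, 'm) bdl" +
  str :: 'm  \<comment> \<open>the structure homomorphism out of the base lattice\<close>

text \<open>The lattice operations on generalised elements.\<close>

definition join_at :: "('o, 'm) ccat \<Rightarrow> ('o, 'm, 'z) bdl_scheme \<Rightarrow> 'm \<Rightarrow> 'm \<Rightarrow> 'm" where
  "join_at C L a b = join L \<bullet>\<^bsub>C\<^esub> tuple C a b"

definition meet_at :: "('o, 'm) ccat \<Rightarrow> ('o, 'm, 'z) bdl_scheme \<Rightarrow> 'm \<Rightarrow> 'm \<Rightarrow> 'm" where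
  "meet_at C L a b = meet L \<bullet>\<^bsub>C\<^esub> tuple C a b"

definition bot_at :: "('o, 'm) ccat \<Rightarrow> ('o, 'm, 'z) bdl_scheme \<Rightarrow> 'o \<Rightarrow> 'm" where
  "bot_at C L \<Gamma> = bot L \<bullet>\<^bsub>C\<^esub> bang C \<Gamma>"

definition top_at :: "('o, 'm) ccat \<Rightarrow> ('o, 'm, 'z) bdl_scheme \<Rightarrow> 'o \<Rightarrow> 'm" where
  "top_at C L \<Gamma> = top L \<bullet>\<^bsub>C\<^esub> bang C \<Gamma>"

definition internal_bdl :: "('o, 'm) ccat \<Rightarrow> ('o, 'm, 'z) bdl_scheme \<Rightarrow> bool" where
  "internal_bdl C L \<longleftrightarrow>
     car L \<in> Obj C \<and>
     join L \<in> hom C (prod_obj C (car L) (car L)) (car L) \<and>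
     meet L \<in> hom C (prod_obj C (car L) (car L)) (car L) \<and>
     bot L \<in> hom C (one C) (car L) \<and>
     top L \<in> hom C (one C) (car L) \<and>
     (\<forall>\<Gamma>\<in>Obj C. \<forall>a\<in>hom C \<Gamma> (car L). \<forall>b\<in>hom C \<Gamma> (car L). \<forall>c\<in>hom C \<Gamma> (car L).
        join_at C L (join_at C L a b) c = join_at C L a (join_at C L b c) \<and>
        meet_at C L (meet_at C L a b) c = meet_at C L a (meet_at C L b c) \<and>
        join_at C L a b = join_at C L b a \<and>
        meet_at C L a b = meet_at C L b a \<and>
        join_at C L a (meet_at C L a b) = a \<and>
        meet_at C L a (join_at C L a b) = a \<and>
        meet_at C L a (join_at C L b c) = join_at C L (meet_at C L a b) (meet_at C L a c) \<and>
        join_at C L a (bot_at C L \<Gamma>) = a \<and>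
        meet_at C L a (top_at C L \<Gamma>) = a)"

definition bdl_hom :: "('o, 'm) ccat \<Rightarrow> ('o, 'm, 'y) bdl_scheme \<Rightarrow> ('o, 'm, 'z) bdl_scheme \<Rightarrow> 'm \<Rightarrow> bool" where
  "bdl_hom C K L f \<longleftrightarrow>
     f \<in> hom C (car K) (car L) \<and>
     (\<forall>\<Gamma>\<in>Obj C. \<forall>a\<in>hom C \<Gamma> (car K). \<forall>b\<in>hom C \<Gamma> (car K).
        f \<bullet>\<^bsub>C\<^esub> join_at C K a b = join_at C L (f \<bullet>\<^bsub>C\<^esub> a) (f \<bullet>\<^bsub>C\<^esub> b) \<and>
        f \<bullet>\<^bsub>C\<^esub> meet_at C K a b = meet_at C L (f \<bullet>\<^bsub>C\<^esub> a) (f \<bullet>\<^bsub>C\<^esub> b) \<and>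
        f \<bullet>\<^bsub>C\<^esub> bot_at C K \<Gamma> = bot_at C L \<Gamma> \<and>
        f \<bullet>\<^bsub>C\<^esub> top_at C K \<Gamma> = top_at C L \<Gamma>)"

definition internal_alg :: "('o, 'm) ccat \<Rightarrow> ('o, 'm) bdl \<Rightarrow> ('o, 'm) alg \<Rightarrow> bool" where
  "internal_alg C I A \<longleftrightarrow> internal_bdl C A \<and> bdl_hom C I A (str A)"

definition alg_hom :: "('o, 'm) ccat \<Rightarrow> ('o, 'm) alg \<Rightarrow> ('o, 'm) alg \<Rightarrow> 'm \<Rightarrow> bool" where
  "alg_hom C A B f \<longleftrightarrow> bdl_hom C A B f \<and> f \<bullet>\<^bsub>C\<^esub> str A = str B"

definition alg_iso :: "('o, 'm) ccat \<Rightarrow> ('o, 'm) alg \<Rightarrow> ('o, 'm) alg \<Rightarrow> 'm \<Rightarrow> bool" where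
  "alg_iso C A B f \<longleftrightarrow> alg_hom C A B f \<and>
     (\<exists>g. alg_hom C B A g \<and> g \<bullet>\<^bsub>C\<^esub> f = ident C (car A) \<and> f \<bullet>\<^bsub>C\<^esub> g = ident C (car B))"

definition base_alg :: "('o, 'm) ccat \<Rightarrow> ('o, 'm) bdl \<Rightarrow> ('o, 'm) alg" where
  "base_alg C I = \<lparr>car = car I, join = join I, meet = meet I, bot = bot I, top = top I,
                   str = ident C (car I)\<rparr>"

text \<open>
  A generalised element \<open>x\<close> of the exponential at stage \<open>\<Gamma>\<close> is a homomorphism if the
  defining equations hold for all elements at all stages \<open>s : \<Delta> \<rightarrow> \<Gamma>\<close> over \<open>\<Gamma>\<close>.
\<close>

definition hom_at ::
  "('o, 'm) ccat \<Rightarrow> ('o, 'm) bdl \<Rightarrow> ('o, 'm) alg \<Rightarrow> ('o, 'm) alg \<Rightarrow> 'o \<Rightarrow> 'm \<Rightarrow> bool" where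
  "hom_at C I A B \<Gamma> x \<longleftrightarrow>
     x \<in> hom C \<Gamma> (exp_obj C (car A) (car B)) \<and>
     (\<forall>\<Delta>\<in>Obj C. \<forall>s\<in>hom C \<Delta> \<Gamma>.
        let h = app C (car A) (car B) (x \<bullet>\<^bsub>C\<^esub> s) in
        (\<forall>a\<in>hom C \<Delta> (car A). \<forall>b\<in>hom C \<Delta> (car A).
           h (join_at C A a b) = join_at C B (h a) (h b) \<and>
           h (meet_at C A a b) = meet_at C B (h a) (h b)) \<and>
        h (bot_at C A \<Delta>) = bot_at C B \<Delta> \<and>
        h (top_at C A \<Delta>) = top_at C B \<Delta> \<and>
        (\<forall>i\<in>hom C \<Delta> (car I). h (str A \<bullet>\<^bsub>C\<^esub> i) = str B \<bullet>\<^bsub>C\<^esub> i))"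

text \<open>
  \<open>S\<close> with inclusion \<open>m\<close> is the object of algebra homomorphisms from \<open>A\<close> to \<open>B\<close>, i.e. the
  subobject of the exponential whose generalised elements are the homomorphisms.
  It is an equaliser, hence exists and is unique up to isomorphism.
\<close>

definition hom_object ::
  "('o, 'm) ccat \<Rightarrow> ('o, 'm) bdl \<Rightarrow> ('o, 'm) alg \<Rightarrow> ('o, 'm) alg \<Rightarrow> 'o \<Rightarrow> 'm \<Rightarrow> bool" where
  "hom_object C I A B S m \<longleftrightarrow>
     S \<in> Obj C \<and> m \<in> hom C S (exp_obj C (car A) (car B)) \<and>
     (\<forall>\<Gamma>\<in>Obj C. bij_betw (\<lambda>y. m \<bullet>\<^bsub>C\<^esub> y) (hom C \<Gamma> S) {x. hom_at C I A B \<Gamma> x})"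

definition is_Spec :: "('o, 'm) ccat \<Rightarrow> ('o, 'm) bdl \<Rightarrow> ('o, 'm) alg \<Rightarrow> 'o \<Rightarrow> 'm \<Rightarrow> bool" where
  "is_Spec C I A S m \<longleftrightarrow> hom_object C I A (base_alg C I) S m"

text \<open>
  The pointwise algebra structure on the exponential; e.g. \<open>join\<close> is
  \<open>(f, g) \<mapsto> \<lambda>x. f x \<or> g x\<close> and \<open>str\<close> is \<open>i \<mapsto> \<lambda>x. i\<close>.
\<close>

definition fun_alg :: "('o, 'm) ccat \<Rightarrow> ('o, 'm) bdl \<Rightarrow> 'o \<Rightarrow> ('o, 'm) alg" where
  "fun_alg C I X =
     (let E = exp_obj C X (car I);
          P = prod_obj C E E;
          f = proj1 C E E \<bullet>\<^bsub>C\<^esub> proj1 C P X;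
          g = proj2 C E E \<bullet>\<^bsub>C\<^esub> proj1 C P X;
          x = proj2 C P X
      in \<lparr>car = E,
          join = curry_arr C P X (join_at C I (app C X (car I) f x) (app C X (car I) g x)),
          meet = curry_arr C P X (meet_at C I (app C X (car I) f x) (app C X (car I) g x)),
          bot = curry_arr C (one C) X (bot_at C I (prod_obj C (one C) X)),
          top = curry_arr C (one C) X (top_at C I (prod_obj C (one C) X)),
          str = curry_arr C (car I) X (proj1 C (car I) X)\<rparr>)"

text \<open>\<open>iota\<close> is \<open>a \<mapsto> \<lambda>x. x a\<close>, where \<open>x\<close> ranges over the spectrum \<open>S\<close> with inclusion \<open>m\<close>.\<close>

definition iota :: "('o, 'm) ccat \<Rightarrow> ('o, 'm) bdl \<Rightarrow> ('o, 'm) alg \<Rightarrow> 'o \<Rightarrow> 'm \<Rightarrow> 'm" where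
  "iota C I A S m =
     curry_arr C (car A) S
       (app C (car A) (car I) (m \<bullet>\<^bsub>C\<^esub> proj2 C (car A) S) (proj1 C (car A) S))"

definition quasi_coherent :: "('o, 'm) ccat \<Rightarrow> ('o, 'm) bdl \<Rightarrow> ('o, 'm) alg \<Rightarrow> bool" where
  "quasi_coherent C I A \<longleftrightarrow>
     (\<exists>S m. is_Spec C I A S m \<and> alg_iso C A (fun_alg C I S) (iota C I A S m))"

text \<open>
  \<open>P\<close> is the free algebra over \<open>A\<close> on the generator \<open>j\<close>, with unit \<open>u\<close>.  The universal
  property is only asked for global \<open>B\<close>, \<open>f\<close>, \<open>b\<close> (the internal one, with these depending on
  a stage, implies it); this already determines \<open>P\<close> up to isomorphism.
\<close>

definition poly_alg ::
  "('o, 'm) ccat \<Rightarrow> ('o, 'm) bdl \<Rightarrow> ('o, 'm) alg \<Rightarrow> ('o, 'm) alg \<Rightarrow> 'm \<Rightarrow> 'm \<Rightarrow> bool" where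
  "poly_alg C I A P u j \<longleftrightarrow>
     internal_alg C I P \<and> alg_hom C A P u \<and> j \<in> hom C (one C) (car P) \<and>
     (\<forall>B f b. internal_alg C I B \<and> alg_hom C A B f \<and> b \<in> hom C (one C) (car B) \<longrightarrow>
        (\<exists>!g. alg_hom C P B g \<and> g \<bullet>\<^bsub>C\<^esub> u = f \<and> g \<bullet>\<^bsub>C\<^esub> j = b))"

definition gen_phoa :: "('o, 'm) ccat \<Rightarrow> ('o, 'm) bdl \<Rightarrow> ('o, 'm) alg \<Rightarrow> bool" where
  "gen_phoa C I A \<longleftrightarrow>
     (\<forall>\<Gamma>\<in>Obj C. \<forall>\<alpha>\<in>hom C \<Gamma> (exp_obj C (car I) (car A)). \<forall>i\<in>hom C \<Gamma> (car I).
        let \<alpha>_at = app C (car I) (car A) \<alpha> in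
        \<alpha>_at i = join_at C A (\<alpha>_at (bot_at C I \<Gamma>))
                   (meet_at C A (str A \<bullet>\<^bsub>C\<^esub> i) (\<alpha>_at (top_at C I \<Gamma>))))"

end

theory Submission
  imports Defs
begin

text \<open>
  Every element of \<open>A[j]\<close> has a unique normal form \<open>a \<or> (j \<and> b)\<close> with \<open>a \<le> b\<close>, its values at
  \<open>0\<close> and \<open>1\<close>; so \<open>A[j]\<close> is the algebra of ordered pairs in \<open>A\<close>.  Its spectrum is
  \<open>Spec A \<times> I\<close>, where \<open>(x, i)\<close> acts by \<open>p \<mapsto> x (p 0) \<or> (i \<and> x (p 1))\<close>.  As \<open>A\<close> is quasi-coherent,
  functions on \<open>Spec A \<times> I\<close> are the same as functions \<open>I \<rightarrow> A\<close>, and the evaluation map of \<open>A[j]\<close>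
  becomes \<open>p \<mapsto> (i \<mapsto> p 0 \<or> (i \<and> p 1))\<close>.  It is always injective, and it is onto exactly when every
  \<open>\<alpha> : I \<rightarrow> A\<close> is the interpolation of its end points, which is the Phoa principle.
\<close>

section \<open>Bounded distributive lattices on a carrier set\<close>

text \<open>The universal property of \<open>A[j]\<close> is available only for global algebras and
  global points, while the spectrum and the Phoa principle quantify over elements at all stages. A
  homomorphism on \<open>A[j]\<close> at a stage \<open>\<Gamma>\<close> therefore cannot be
  produced by freeness. Freeness is used only globally: it yields the map from \<open>A[j]\<close>
  to the ordered pairs that sends the generator to \<open>(0, 1)\<close> and constants to the
  diagonal, and its uniqueness clause shows that interpolation is a left inverse of this map. The
  resulting coordinates are arrows, so they act on elements at every stage; homomorphisms on
  \<open>A[j]\<close> are from then on written down by formula. The pairs have to be ordered because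
  interpolation \<open>a \<or> (c \<and> b)\<close> always preserves joins, but in general preserves
  meets only when the lower end points lie below the upper ones: otherwise a product has cross terms
  such as \<open>c \<and> a \<and> b'\<close> that need not lie below
  \<open>c \<and> b \<and> b'\<close>.\<close>

locale bd_lattice =
  fixes S :: "'a set" and J M :: "'a \<Rightarrow> 'a \<Rightarrow> 'a" and z e :: 'a
  assumes J_closed [simp]: "a \<in> S \<Longrightarrow> b \<in> S \<Longrightarrow> J a b \<in> S"
    and M_closed [simp]: "a \<in> S \<Longrightarrow> b \<in> S \<Longrightarrow> M a b \<in> S"
    and z_closed [simp]: "z \<in> S" and e_closed [simp]: "e \<in> S"
    and J_assoc: "a \<in> S \<Longrightarrow> b \<in> S \<Longrightarrow> c \<in> S \<Longrightarrow> J (J a b) c = J a (J b c)"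
    and M_assoc: "a \<in> S \<Longrightarrow> b \<in> S \<Longrightarrow> c \<in> S \<Longrightarrow> M (M a b) c = M a (M b c)"
    and J_commute: "a \<in> S \<Longrightarrow> b \<in> S \<Longrightarrow> J a b = J b a"
    and M_commute: "a \<in> S \<Longrightarrow> b \<in> S \<Longrightarrow> M a b = M b a"
    and J_absorb: "a \<in> S \<Longrightarrow> b \<in> S \<Longrightarrow> J a (M a b) = a"
    and M_absorb: "a \<in> S \<Longrightarrow> b \<in> S \<Longrightarrow> M a (J a b) = a"
    and M_distrib: "a \<in> S \<Longrightarrow> b \<in> S \<Longrightarrow> c \<in> S \<Longrightarrow> M a (J b c) = J (M a b) (M a c)"
    and J_z: "a \<in> S \<Longrightarrow> J a z = a"
    and M_e: "a \<in> S \<Longrightarrow> M a e = a"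
begin

lemma J_left_commute: "a \<in> S \<Longrightarrow> b \<in> S \<Longrightarrow> c \<in> S \<Longrightarrow> J a (J b c) = J b (J a c)"
  by (metis J_assoc J_commute)

lemma M_left_commute: "a \<in> S \<Longrightarrow> b \<in> S \<Longrightarrow> c \<in> S \<Longrightarrow> M a (M b c) = M b (M a c)"
  by (metis M_assoc M_commute)

lemma J_idem: "a \<in> S \<Longrightarrow> J a a = a"
  by (metis J_absorb M_e e_closed)

lemma z_M: "a \<in> S \<Longrightarrow> M z a = z"
  by (metis J_commute J_z M_absorb z_closed)

lemma J_of_le: "a \<in> S \<Longrightarrow> b \<in> S \<Longrightarrow> M a b = a \<Longrightarrow> J a b = b"
  by (metis J_absorb J_commute M_commute)

lemma M_distrib_right: "a \<in> S \<Longrightarrow> b \<in> S \<Longrightarrow> c \<in> S \<Longrightarrow> M (J b c) a = J (M b a) (M c a)"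
  by (metis J_closed M_commute M_distrib)

lemma J_distrib: "a \<in> S \<Longrightarrow> b \<in> S \<Longrightarrow> c \<in> S \<Longrightarrow> M (J a b) (J a c) = J a (M b c)"
  by (simp add: M_distrib M_distrib_right J_assoc M_absorb)
     (metis J_absorb J_assoc M_absorb M_closed M_commute M_distrib J_closed)

text \<open>The order \<open>a \<le> b\<close> is encoded as \<open>M a b = a\<close>. In the
  equivalent form \<open>J a b = b\<close> the upper join contains the lower one as a summand, and
  absorption finishes.\<close>

lemma le_J:
  assumes "a \<in> S" "b \<in> S" "a' \<in> S" "b' \<in> S" "M a b = a" "M a' b' = a'"
  shows "M (J a a') (J b b') = J a a'"
proof -
  have "J b b' = J (J a a') (J b b')"
    using assms by (metis J_assoc J_closed J_left_commute J_of_le)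
  with assms show ?thesis by (metis J_closed M_absorb)
qed

lemma le_M:
  assumes "a \<in> S" "b \<in> S" "a' \<in> S" "b' \<in> S" "M a b = a" "M a' b' = a'"
  shows "M (M a a') (M b b') = M a a'"
  using assms by (metis M_assoc M_closed M_left_commute)

text \<open>The value at \<open>c\<close> of the polynomial with end points \<open>a\<close> and \<open>b\<close>.\<close>

definition mix :: "'a \<Rightarrow> 'a \<Rightarrow> 'a \<Rightarrow> 'a" where
  "mix c a b = J a (M c b)"

lemma mix_J:
  assumes "c \<in> S" "a \<in> S" "b \<in> S" "a' \<in> S" "b' \<in> S"
  shows "mix c (J a a') (J b b') = J (mix c a b) (mix c a' b')"
  using assms by (simp add: mix_def M_distrib J_assoc J_left_commute)

text \<open>For \<open>a \<le> b\<close> the interpolant has a dual form as a meet, since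
  \<open>(a \<or> b) \<and> (a \<or> c)\<close> has first factor \<open>b\<close>. This form is the
  one suited to computing meets.\<close>

lemma mix_eq_M:
  assumes "c \<in> S" "a \<in> S" "b \<in> S" "M a b = a"
  shows "mix c a b = M b (J a c)"
  using assms by (metis J_closed J_distrib J_of_le J_commute M_commute mix_def)

text \<open>Written as meets by \<open>mix_eq_M\<close>, the interpolants multiply factor by factor,
  and the two factors that contain \<open>c\<close> merge by \<open>J_distrib\<close>.\<close>

lemma mix_M:
  assumes "c \<in> S" "a \<in> S" "b \<in> S" "a' \<in> S" "b' \<in> S" "M a b = a" "M a' b' = a'"
  shows "mix c (M a a') (M b b') = M (mix c a b) (mix c a' b')"
proof -
  have "mix c (M a a') (M b b') = M (M b b') (J (M a a') c)"
    using assms by (intro mix_eq_M) (auto simp: le_M)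
  also have "\<dots> = M (M b b') (M (J a c) (J a' c))"
    using assms J_distrib[of c a a'] by (simp add: J_commute)
  also have "\<dots> = M (M b (J a c)) (M b' (J a' c))"
    using assms by (simp add: M_assoc M_left_commute)
  finally show ?thesis using assms by (simp add: mix_eq_M)
qed

text \<open>Equal end points give a constant polynomial; this evaluates the bounds, the scalars and
  the image of \<open>u\<close>.\<close>

lemma mix_same: "c \<in> S \<Longrightarrow> a \<in> S \<Longrightarrow> mix c a a = a"
  by (metis J_absorb M_commute mix_def)

lemma mix_z: "a \<in> S \<Longrightarrow> b \<in> S \<Longrightarrow> mix z a b = a"
  by (simp add: mix_def z_M J_z)

text \<open>The value at the top is \<open>J a b\<close>, which is the upper end point only when
  \<open>a \<le> b\<close>.\<close>

lemma mix_e: "a \<in> S \<Longrightarrow> b \<in> S \<Longrightarrow> mix e a b = J a b"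
  by (metis M_commute M_e e_closed mix_def)

text \<open>The pair \<open>(z, e)\<close> stands for the polynomial variable.\<close>

lemma mix_z_e: "c \<in> S \<Longrightarrow> mix c z e = c"
  by (metis J_commute J_z M_e mix_def z_closed)

lemma mix_J_right: "c \<in> S \<Longrightarrow> a \<in> S \<Longrightarrow> b \<in> S \<Longrightarrow> mix c a (J a b) = mix c a b"
  by (metis J_assoc J_absorb M_closed M_commute M_distrib mix_def)

end

section \<open>Generalised elements\<close>

lemma hom_iff: "f \<in> hom C X Y \<longleftrightarrow> f \<in> Arr C \<and> Dom C f = X \<and> Cod C f = Y"
  by (auto simp: hom_def)

context fin_complete_ccc
begin

text \<open>
  Typing is expressed by equations for \<^const>\<open>Dom\<close> and \<^const>\<open>Cod\<close> rather than by membership in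
  \<^const>\<open>hom\<close>, so that the simplifier never has to guess an intermediate object.
\<close>

lemma comp_type [simp]:
  assumes "f \<in> Arr C" "g \<in> Arr C" "Dom C g = Cod C f"
  shows "g \<bullet> f \<in> Arr C" "Dom C (g \<bullet> f) = Dom C f" "Cod C (g \<bullet> f) = Cod C g"
  using comp_hom[of f "Dom C f" "Cod C f" g "Cod C g"] assms by (auto simp: hom_iff)

lemma ident_type [simp]:
  assumes "X \<in> Obj C"
  shows "ident C X \<in> Arr C" "Dom C (ident C X) = X" "Cod C (ident C X) = X"
  using ident_hom[of X] assms by (auto simp: hom_iff)

lemma comp_assoc' [simp]:
  assumes "f \<in> Arr C" "g \<in> Arr C" "h \<in> Arr C" "Dom C g = Cod C f" "Dom C h = Cod C g"
  shows "(h \<bullet> g) \<bullet> f = h \<bullet> (g \<bullet> f)"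
  using comp_assoc[of f "Dom C f" "Cod C f" g "Cod C g" h "Cod C h"] assms by (auto simp: hom_iff)

lemma ident_left' [simp]: "f \<in> Arr C \<Longrightarrow> Cod C f = X \<Longrightarrow> ident C X \<bullet> f = f"
  using ident_left[of f "Dom C f" X] by (auto simp: hom_iff)

lemma ident_right' [simp]: "f \<in> Arr C \<Longrightarrow> Dom C f = X \<Longrightarrow> f \<bullet> ident C X = f"
  using ident_right[of f X "Cod C f"] by (auto simp: hom_iff)

lemma bang_type [simp]:
  assumes "X \<in> Obj C"
  shows "bang C X \<in> Arr C" "Dom C (bang C X) = X" "Cod C (bang C X) = one C"
  using bang_hom[of X] assms by (auto simp: hom_iff)

lemma bang_eq:
  assumes "f \<in> Arr C" "Cod C f = one C"
  shows "f = bang C (Dom C f)"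
  using bang_unique[of f "Dom C f"] assms by (auto simp: hom_iff)

lemma bang_comp [simp]:
  assumes "f \<in> Arr C" "Cod C f = X"
  shows "bang C X \<bullet> f = bang C (Dom C f)"
  using bang_eq[of "bang C X \<bullet> f"] assms cod_obj[of f] by simp

lemma bang_one [simp]: "bang C (one C) = ident C (one C)"
  using bang_eq[of "ident C (one C)"] one_obj by simp

declare dom_obj [simp] cod_obj [simp] one_obj [simp] prod_obj [simp] exp_obj [simp]

lemma proj_type [simp]:
  assumes "X \<in> Obj C" "Y \<in> Obj C"
  shows "proj1 C X Y \<in> Arr C" "Dom C (proj1 C X Y) = prod_obj C X Y" "Cod C (proj1 C X Y) = X"
    "proj2 C X Y \<in> Arr C" "Dom C (proj2 C X Y) = prod_obj C X Y" "Cod C (proj2 C X Y) = Y"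
  using proj1_hom[OF assms] proj2_hom[OF assms] by (auto simp: hom_iff)

lemma tuple_type [simp]:
  assumes "f \<in> Arr C" "g \<in> Arr C" "Dom C f = Dom C g"
  shows "tuple C f g \<in> Arr C" "Dom C (tuple C f g) = Dom C g"
    "Cod C (tuple C f g) = prod_obj C (Cod C f) (Cod C g)"
  using tuple_hom[of f "Dom C f" "Cod C f" g "Cod C g"] assms by (auto simp: hom_iff)

lemma proj_tuple [simp]:
  assumes "f \<in> Arr C" "g \<in> Arr C" "Dom C f = Dom C g" "Cod C f = X" "Cod C g = Y"
  shows "proj1 C X Y \<bullet> tuple C f g = f" "proj2 C X Y \<bullet> tuple C f g = g"
  using proj1_tuple[of f "Dom C f" X g Y] proj2_tuple[of f "Dom C f" X g Y] assms
  by (auto simp: hom_iff)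

lemma tuple_eta:
  assumes "X \<in> Obj C" "Y \<in> Obj C" "h \<in> Arr C" "Cod C h = prod_obj C X Y"
  shows "tuple C (proj1 C X Y \<bullet> h) (proj2 C X Y \<bullet> h) = h"
  using tuple_unique[of X Y h "Dom C h"] assms by (auto simp: hom_iff)

lemma prod_ext:
  assumes "X \<in> Obj C" "Y \<in> Obj C" "h \<in> Arr C" "Cod C h = prod_obj C X Y"
    and "k \<in> Arr C" "Cod C k = prod_obj C X Y"
    and "proj1 C X Y \<bullet> h = proj1 C X Y \<bullet> k" "proj2 C X Y \<bullet> h = proj2 C X Y \<bullet> k"
  shows "h = k"
  using assms tuple_eta by metis

text \<open>In a composite nested to the right, the two adjacent arrows that
  \<open>proj_tuple\<close> cancels do not form a subterm; this variant covers that case.\<close>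

lemma proj_tuple_comp [simp]:
  assumes "f \<in> Arr C" "g \<in> Arr C" "Dom C f = Dom C g" "Cod C f = X" "Cod C g = Y"
    "s \<in> Arr C" "Cod C s = Dom C g"
  shows "proj1 C X Y \<bullet> tuple C f g \<bullet> s = f \<bullet> s" "proj2 C X Y \<bullet> tuple C f g \<bullet> s = g \<bullet> s"
proof -
  have "X \<in> Obj C" "Y \<in> Obj C" using assms by auto
  then show "proj1 C X Y \<bullet> tuple C f g \<bullet> s = f \<bullet> s" "proj2 C X Y \<bullet> tuple C f g \<bullet> s = g \<bullet> s"
    using assms by (simp_all flip: comp_assoc')
qed

lemma tuple_comp [simp]:
  assumes "f \<in> Arr C" "g \<in> Arr C" "Dom C f = Dom C g" "s \<in> Arr C" "Cod C s = Dom C g"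
  shows "tuple C f g \<bullet> s = tuple C (f \<bullet> s) (g \<bullet> s)"
  by (rule prod_ext[of "Cod C f" "Cod C g"]) (use assms in auto)

lemma ev_type [simp]:
  assumes "X \<in> Obj C" "Y \<in> Obj C"
  shows "ev C X Y \<in> Arr C" "Dom C (ev C X Y) = prod_obj C (exp_obj C X Y) X" "Cod C (ev C X Y) = Y"
  using ev_hom[OF assms] by (auto simp: hom_iff)

lemma app_type [simp]:
  assumes "X \<in> Obj C" "Y \<in> Obj C" "f \<in> Arr C" "a \<in> Arr C" "Dom C f = Dom C a"
    "Cod C f = exp_obj C X Y" "Cod C a = X"
  shows "app C X Y f a \<in> Arr C" "Dom C (app C X Y f a) = Dom C a" "Cod C (app C X Y f a) = Y"
  using assms by (auto simp: app_def)

lemma app_comp [simp]: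
  assumes "X \<in> Obj C" "Y \<in> Obj C" "f \<in> Arr C" "a \<in> Arr C" "Dom C f = Dom C a"
    "Cod C f = exp_obj C X Y" "Cod C a = X" "s \<in> Arr C" "Cod C s = Dom C a"
  shows "app C X Y f a \<bullet> s = app C X Y (f \<bullet> s) (a \<bullet> s)"
  using assms by (auto simp: app_def)

lemma curry_type [simp]:
  assumes "W \<in> Obj C" "X \<in> Obj C" "f \<in> Arr C" "Dom C f = prod_obj C W X"
  shows "curry_arr C W X f \<in> Arr C" "Dom C (curry_arr C W X f) = W"
    "Cod C (curry_arr C W X f) = exp_obj C X (Cod C f)"
  using curry_hom[of W X f "Cod C f"] assms by (auto simp: hom_iff)

text \<open>The beta rule at an arbitrary stage and argument. The axiom \<open>curry_app\<close>
  gives it for the generic pair of projections; precomposition with \<open>tuple C s a\<close> gives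
  the rest.\<close>

lemma app_curry_comp [simp]:
  assumes "W \<in> Obj C" "X \<in> Obj C" "f \<in> Arr C" "Dom C f = prod_obj C W X" "Cod C f = Y"
    "s \<in> Arr C" "Cod C s = W" "a \<in> Arr C" "Cod C a = X" "Dom C s = Dom C a"
  shows "app C X Y (curry_arr C W X f \<bullet> s) a = f \<bullet> tuple C s a"
proof -
  have Y: "Y \<in> Obj C" using assms by auto
  have "f \<bullet> tuple C s a = app C X Y (curry_arr C W X f \<bullet> proj1 C W X) (proj2 C W X) \<bullet> tuple C s a"
    using curry_app[of W X f Y] assms by (auto simp: hom_iff)
  also have "\<dots> = app C X Y (curry_arr C W X f \<bullet> s) a"
    using assms Y by (simp del: tuple_comp)
  finally show ?thesis by simp
qed

text \<open>Function extensionality for generalised elements. The premise is applied at one stage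
  only, the generic one \<open>\<Gamma> \<times> X\<close>, and the eta rule recovers
  \<open>f\<close> and \<open>g\<close> from their values there.\<close>

lemma exp_ext:
  assumes "X \<in> Obj C" "Y \<in> Obj C" "f \<in> Arr C" "g \<in> Arr C"
    "Dom C f = \<Gamma>" "Dom C g = \<Gamma>" "Cod C f = exp_obj C X Y" "Cod C g = exp_obj C X Y"
    and eq: "\<And>\<Delta> s a. \<Delta> \<in> Obj C \<Longrightarrow> s \<in> Arr C \<Longrightarrow> Dom C s = \<Delta> \<Longrightarrow> Cod C s = \<Gamma> \<Longrightarrow> a \<in> Arr C \<Longrightarrow> Dom C a = \<Delta>
              \<Longrightarrow> Cod C a = X \<Longrightarrow> app C X Y (f \<bullet> s) a = app C X Y (g \<bullet> s) a"
  shows "f = g"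
proof -
  have \<Gamma>: "\<Gamma> \<in> Obj C" using assms by auto
  have "app C X Y (f \<bullet> proj1 C \<Gamma> X) (proj2 C \<Gamma> X) = app C X Y (g \<bullet> proj1 C \<Gamma> X) (proj2 C \<Gamma> X)"
    by (rule eq[of "prod_obj C \<Gamma> X"]) (use assms(1-8) \<Gamma> in auto)
  moreover have "curry_arr C \<Gamma> X (app C X Y (h \<bullet> proj1 C \<Gamma> X) (proj2 C \<Gamma> X)) = h"
    if "h \<in> {f, g}" for h
    by (rule curry_unique) (use assms(1-8) \<Gamma> that in \<open>auto simp: hom_iff\<close>)
  ultimately show ?thesis by (metis insertI1 insertI2)
qed

section \<open>Internal lattices and their homomorphisms\<close>

lemma bdl_car [simp]: "internal_bdl C L \<Longrightarrow> car L \<in> Obj C"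
  by (simp add: internal_bdl_def)

lemma bdl_ops_type:
  assumes "internal_bdl C L"
  shows "join L \<in> Arr C" "Dom C (join L) = prod_obj C (car L) (car L)" "Cod C (join L) = car L"
    "meet L \<in> Arr C" "Dom C (meet L) = prod_obj C (car L) (car L)" "Cod C (meet L) = car L"
    "bot L \<in> Arr C" "Dom C (bot L) = one C" "Cod C (bot L) = car L"
    "top L \<in> Arr C" "Dom C (top L) = one C" "Cod C (top L) = car L"
  using assms by (auto simp: internal_bdl_def hom_iff)

lemma at_type [simp]:
  assumes "internal_bdl C L"
  shows "\<lbrakk>a \<in> Arr C; b \<in> Arr C; Dom C a = Dom C b; Cod C a = car L; Cod C b = car L\<rbrakk> \<Longrightarrow>
      join_at C L a b \<in> Arr C \<and> Dom C (join_at C L a b) = Dom C b \<and> Cod C (join_at C L a b) = car L"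
    "\<lbrakk>a \<in> Arr C; b \<in> Arr C; Dom C a = Dom C b; Cod C a = car L; Cod C b = car L\<rbrakk> \<Longrightarrow>
      meet_at C L a b \<in> Arr C \<and> Dom C (meet_at C L a b) = Dom C b \<and> Cod C (meet_at C L a b) = car L"
    "\<Gamma> \<in> Obj C \<Longrightarrow> bot_at C L \<Gamma> \<in> Arr C \<and> Dom C (bot_at C L \<Gamma>) = \<Gamma> \<and> Cod C (bot_at C L \<Gamma>) = car L"
    "\<Gamma> \<in> Obj C \<Longrightarrow> top_at C L \<Gamma> \<in> Arr C \<and> Dom C (top_at C L \<Gamma>) = \<Gamma> \<and> Cod C (top_at C L \<Gamma>) = car L"
  using bdl_ops_type[OF assms] by (simp_all add: join_at_def meet_at_def bot_at_def top_at_def)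

lemma at_comp [simp]:
  assumes "internal_bdl C L" "s \<in> Arr C"
  shows "\<lbrakk>a \<in> Arr C; b \<in> Arr C; Dom C a = Dom C b; Cod C a = car L; Cod C b = car L; Cod C s = Dom C b\<rbrakk> \<Longrightarrow>
      join_at C L a b \<bullet> s = join_at C L (a \<bullet> s) (b \<bullet> s)"
    "\<lbrakk>a \<in> Arr C; b \<in> Arr C; Dom C a = Dom C b; Cod C a = car L; Cod C b = car L; Cod C s = Dom C b\<rbrakk> \<Longrightarrow>
      meet_at C L a b \<bullet> s = meet_at C L (a \<bullet> s) (b \<bullet> s)"
    "Cod C s = \<Gamma> \<Longrightarrow> bot_at C L \<Gamma> \<bullet> s = bot_at C L (Dom C s)"
    "Cod C s = \<Gamma> \<Longrightarrow> top_at C L \<Gamma> \<bullet> s = top_at C L (Dom C s)"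
  using bdl_ops_type[OF assms(1)] assms(2)
  by (auto simp add: join_at_def meet_at_def bot_at_def top_at_def)

text \<open>The elements at a fixed stage form an ordinary lattice, so the calculus of
  \<open>bd_lattice\<close>, in particular that of \<open>mix\<close>, applies stage by
  stage.\<close>

lemma bd_lattice_hom:
  assumes "internal_bdl C L" "\<Gamma> \<in> Obj C"
  shows "bd_lattice (hom C \<Gamma> (car L)) (join_at C L) (meet_at C L) (bot_at C L \<Gamma>) (top_at C L \<Gamma>)"
proof
  fix a b c assume "a \<in> hom C \<Gamma> (car L)" "b \<in> hom C \<Gamma> (car L)" "c \<in> hom C \<Gamma> (car L)"
  then show "join_at C L (join_at C L a b) c = join_at C L a (join_at C L b c)"
        "meet_at C L (meet_at C L a b) c = meet_at C L a (meet_at C L b c)"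
        "meet_at C L a (join_at C L b c) = join_at C L (meet_at C L a b) (meet_at C L a c)"
    using assms unfolding internal_bdl_def by blast+
next
  fix a b assume "a \<in> hom C \<Gamma> (car L)" "b \<in> hom C \<Gamma> (car L)"
  then show "join_at C L a b = join_at C L b a"
        "meet_at C L a b = meet_at C L b a"
        "join_at C L a (meet_at C L a b) = a"
        "meet_at C L a (join_at C L a b) = a"
    using assms unfolding internal_bdl_def by blast+
next
  fix a assume "a \<in> hom C \<Gamma> (car L)"
  then show "join_at C L a (bot_at C L \<Gamma>) = a" "meet_at C L a (top_at C L \<Gamma>) = a"
    using assms unfolding internal_bdl_def by blast+
qed (use assms in \<open>auto simp: hom_iff\<close>)

declare hom_iff [simp]

text \<open>The interpolant \<open>mix\<close> without reference to a stage, so that its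
  compatibility with reindexing can be stated.\<close>

definition mix_at :: "('a, 'b, 'z) bdl_scheme \<Rightarrow> 'b \<Rightarrow> 'b \<Rightarrow> 'b \<Rightarrow> 'b" where
  "mix_at L c a b = join_at C L a (meet_at C L c b)"

context
  fixes L :: "('a, 'b, 'z) bdl_scheme" and \<Gamma> :: 'a
  assumes L: "internal_bdl C L" and \<Gamma>: "\<Gamma> \<in> Obj C"
begin

interpretation bd_lattice "hom C \<Gamma> (car L)" "join_at C L" "meet_at C L" "bot_at C L \<Gamma>" "top_at C L \<Gamma>"
  by (rule bd_lattice_hom[OF L \<Gamma>])

lemmas lattice_at =
  J_closed M_closed z_closed e_closed J_assoc M_assoc J_commute M_commute J_absorb M_absorb
  M_distrib J_z M_e

lemmas order_at = le_J le_M z_M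

text \<open>In order: joins, meets, constant polynomials, the values at bottom and top, the
  variable, and absorption in the upper end point.\<close>

lemmas mix_at = mix_J[unfolded mix_def, folded mix_at_def] mix_M[unfolded mix_def, folded mix_at_def]
  mix_same[unfolded mix_def, folded mix_at_def] mix_z[unfolded mix_def, folded mix_at_def]
  mix_e[unfolded mix_def, folded mix_at_def] mix_z_e[unfolded mix_def, folded mix_at_def]
  mix_J_right[unfolded mix_def, folded mix_at_def]

lemma le_join_at: "a \<in> hom C \<Gamma> (car L) \<Longrightarrow> b \<in> hom C \<Gamma> (car L) \<Longrightarrow> meet_at C L a b = a \<Longrightarrow> join_at C L a b = b"
  by (rule J_of_le)

lemma meet_idem_at: "a \<in> hom C \<Gamma> (car L) \<Longrightarrow> meet_at C L a a = a"
  by (metis J_idem M_absorb)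

end

lemma mix_at_type [simp]:
  assumes "internal_bdl C L" "a \<in> Arr C" "b \<in> Arr C" "c \<in> Arr C" "Dom C a = Dom C b" "Dom C c = Dom C b"
    "Cod C a = car L" "Cod C b = car L" "Cod C c = car L"
  shows "mix_at L c a b \<in> Arr C" "Dom C (mix_at L c a b) = Dom C b" "Cod C (mix_at L c a b) = car L"
  using assms by (auto simp: mix_at_def)

lemma mix_at_comp [simp]:
  assumes "internal_bdl C L" "a \<in> Arr C" "b \<in> Arr C" "c \<in> Arr C" "Dom C a = Dom C b" "Dom C c = Dom C b"
    "Cod C a = car L" "Cod C b = car L" "Cod C c = car L" "s \<in> Arr C" "Cod C s = Dom C b"
  shows "mix_at L c a b \<bullet> s = mix_at L (c \<bullet> s) (a \<bullet> s) (b \<bullet> s)"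
  using assms by (auto simp: mix_at_def)

lemma bdl_hom_type:
  assumes "bdl_hom C K L f"
  shows "f \<in> Arr C" "Dom C f = car K" "Cod C f = car L"
  using assms by (auto simp: bdl_hom_def)

text \<open>
  In \<^const>\<open>bdl_hom\<close> the equations for the constants at stage \<open>\<Gamma>\<close> are guarded by elements of the
  domain at \<open>\<Gamma>\<close>; that \<open>K\<close> is a lattice provides such elements.
\<close>

lemma bdl_hom_at:
  assumes "bdl_hom C K L f" "internal_bdl C K"
  shows "\<lbrakk>a \<in> Arr C; b \<in> Arr C; Dom C a = Dom C b; Cod C a = car K; Cod C b = car K\<rbrakk> \<Longrightarrow>
      f \<bullet> join_at C K a b = join_at C L (f \<bullet> a) (f \<bullet> b)"
    "\<lbrakk>a \<in> Arr C; b \<in> Arr C; Dom C a = Dom C b; Cod C a = car K; Cod C b = car K\<rbrakk> \<Longrightarrow>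
      f \<bullet> meet_at C K a b = meet_at C L (f \<bullet> a) (f \<bullet> b)"
    "\<Gamma> \<in> Obj C \<Longrightarrow> f \<bullet> bot_at C K \<Gamma> = bot_at C L \<Gamma>"
    "\<Gamma> \<in> Obj C \<Longrightarrow> f \<bullet> top_at C K \<Gamma> = top_at C L \<Gamma>"
proof -
  have *: "f \<bullet> join_at C K a b = join_at C L (f \<bullet> a) (f \<bullet> b) \<and>
        f \<bullet> meet_at C K a b = meet_at C L (f \<bullet> a) (f \<bullet> b) \<and>
        f \<bullet> bot_at C K \<Gamma> = bot_at C L \<Gamma> \<and>
        f \<bullet> top_at C K \<Gamma> = top_at C L \<Gamma>"
    if "\<Gamma> \<in> Obj C" "a \<in> hom C \<Gamma> (car K)" "b \<in> hom C \<Gamma> (car K)" for \<Gamma> a b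
    using assms that unfolding bdl_hom_def by blast
  show "\<lbrakk>a \<in> Arr C; b \<in> Arr C; Dom C a = Dom C b; Cod C a = car K; Cod C b = car K\<rbrakk> \<Longrightarrow>
      f \<bullet> join_at C K a b = join_at C L (f \<bullet> a) (f \<bullet> b)"
    "\<lbrakk>a \<in> Arr C; b \<in> Arr C; Dom C a = Dom C b; Cod C a = car K; Cod C b = car K\<rbrakk> \<Longrightarrow>
      f \<bullet> meet_at C K a b = meet_at C L (f \<bullet> a) (f \<bullet> b)"
    using *[of "Dom C b" a b] by auto
  show "f \<bullet> bot_at C K \<Gamma> = bot_at C L \<Gamma>" "f \<bullet> top_at C K \<Gamma> = top_at C L \<Gamma>" if "\<Gamma> \<in> Obj C"
    using *[of \<Gamma> "bot_at C K \<Gamma>" "bot_at C K \<Gamma>"] assms(2) that by simp_all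
qed

lemma bdl_hom_ident: "internal_bdl C L \<Longrightarrow> bdl_hom C L L (ident C (car L))"
  by (simp add: bdl_hom_def)

lemma bdl_hom_comp:
  assumes "internal_bdl C K" "internal_bdl C L" "bdl_hom C K L f" "bdl_hom C L M g"
  shows "bdl_hom C K M (g \<bullet> f)"
  using assms bdl_hom_type[OF assms(3)] bdl_hom_type[OF assms(4)]
  by (simp add: bdl_hom_def bdl_hom_at[OF assms(3,1)] bdl_hom_at[OF assms(4,2)])

lemma alg_hom_bdl: "alg_hom C A B f \<Longrightarrow> bdl_hom C A B f"
  and alg_hom_str: "alg_hom C A B f \<Longrightarrow> f \<bullet> str A = str B"
  by (simp_all add: alg_hom_def)

lemma alg_bdl: "internal_alg C I A \<Longrightarrow> internal_bdl C A"
  by (simp add: internal_alg_def)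

lemma str_type:
  assumes "internal_alg C I A"
  shows "str A \<in> Arr C" "Dom C (str A) = car I" "Cod C (str A) = car A"
  using assms by (auto simp: internal_alg_def dest: bdl_hom_type)

lemma alg_hom_ident: "internal_alg C I A \<Longrightarrow> alg_hom C A A (ident C (car A))"
  using str_type[of I A] by (simp add: alg_hom_def alg_bdl bdl_hom_ident)

lemma alg_hom_comp:
  assumes "internal_alg C I A" "internal_alg C I B" "alg_hom C A B f" "alg_hom C B D g"
  shows "alg_hom C A D (g \<bullet> f)"
  using assms bdl_hom_type[of A B f] bdl_hom_type[of B D g] str_type[of I A]
  by (simp add: alg_hom_def alg_bdl bdl_hom_comp[of A B f D g])

text \<open>The lattice laws are equations, and jointly monic maps that preserve the operations
  reflect equations. Since \<open>B\<close> is not yet known to be a lattice, preservation is read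
  off the definition of \<open>bdl_hom\<close> and not taken from \<open>bdl_hom_at\<close>.\<close>

lemma internal_bdl_jointly_monic:
  assumes L: "internal_bdl C L"
    and obj: "car B \<in> Obj C"
    and ops: "join B \<in> hom C (prod_obj C (car B) (car B)) (car B)"
      "meet B \<in> hom C (prod_obj C (car B) (car B)) (car B)"
      "bot B \<in> hom C (one C) (car B)" "top B \<in> hom C (one C) (car B)"
    and homs: "bdl_hom C B L e0" "bdl_hom C B L e1"
    and monic: "\<And>\<Gamma> k l. k \<in> hom C \<Gamma> (car B) \<Longrightarrow> l \<in> hom C \<Gamma> (car B) \<Longrightarrow>
      e0 \<bullet> k = e0 \<bullet> l \<Longrightarrow> e1 \<bullet> k = e1 \<bullet> l \<Longrightarrow> k = l"
  shows "internal_bdl C B"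
proof -
  have "join_at C B (join_at C B a b) c = join_at C B a (join_at C B b c) \<and>
        meet_at C B (meet_at C B a b) c = meet_at C B a (meet_at C B b c) \<and>
        join_at C B a b = join_at C B b a \<and>
        meet_at C B a b = meet_at C B b a \<and>
        join_at C B a (meet_at C B a b) = a \<and>
        meet_at C B a (join_at C B a b) = a \<and>
        meet_at C B a (join_at C B b c) = join_at C B (meet_at C B a b) (meet_at C B a c) \<and>
        join_at C B a (bot_at C B \<Gamma>) = a \<and>
        meet_at C B a (top_at C B \<Gamma>) = a"
    if \<Gamma>: "\<Gamma> \<in> Obj C" and abc: "a \<in> hom C \<Gamma> (car B)" "b \<in> hom C \<Gamma> (car B)" "c \<in> hom C \<Gamma> (car B)"
    for \<Gamma> a b c
  proof -
    have closed: "join_at C B x y \<in> hom C \<Gamma> (car B)" "meet_at C B x y \<in> hom C \<Gamma> (car B)"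
      if "x \<in> hom C \<Gamma> (car B)" "y \<in> hom C \<Gamma> (car B)" for x y
      using that ops by (simp_all add: join_at_def meet_at_def)
    have extremal: "bot_at C B \<Gamma> \<in> hom C \<Gamma> (car B)" "top_at C B \<Gamma> \<in> hom C \<Gamma> (car B)"
      using \<Gamma> ops by (simp_all add: bot_at_def top_at_def)
    have pres: "f \<bullet> join_at C B x y = join_at C L (f \<bullet> x) (f \<bullet> y)"
      "f \<bullet> meet_at C B x y = meet_at C L (f \<bullet> x) (f \<bullet> y)"
      "f \<bullet> bot_at C B \<Gamma> = bot_at C L \<Gamma>" "f \<bullet> top_at C B \<Gamma> = top_at C L \<Gamma>"
      if "f \<in> {e0, e1}" "x \<in> hom C \<Gamma> (car B)" "y \<in> hom C \<Gamma> (car B)" for f x y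
      using that homs \<Gamma> unfolding bdl_hom_def by blast+
    have typing: "f \<bullet> x \<in> hom C \<Gamma> (car L)" if "f \<in> {e0, e1}" "x \<in> hom C \<Gamma> (car B)" for f x
      using that homs bdl_hom_type[of B L f] by auto
    note [simp del] = hom_iff
    \<comment> \<open>Preservation of the two bounds is guarded by elements at the stage;
      \<open>a\<close> serves for both guards.\<close>
    note laws = closed extremal abc pres[OF _ abc(1) abc(1)] pres typing
    show ?thesis
      by (intro conjI; rule monic[of _ \<Gamma>];
          simp add: laws lattice_at(1-4)[OF L \<Gamma>];
          (rule lattice_at(5-)[OF L \<Gamma>]; simp add: laws)?)
  qed
  with obj ops show ?thesis unfolding internal_bdl_def by blast
qed

section \<open>Ordered pairs and the normal form of polynomials\<close>

definition ordered_pairs :: "('a, 'b, 'z) bdl_scheme \<Rightarrow> 'a \<Rightarrow> 'b \<Rightarrow> 'b \<Rightarrow> bool" where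
  "ordered_pairs L E e0 e1 \<longleftrightarrow> E \<in> Obj C \<and> e0 \<in> hom C E (car L) \<and> e1 \<in> hom C E (car L) \<and>
    (\<forall>\<Gamma> k. k \<in> hom C \<Gamma> E \<longrightarrow> meet_at C L (e0 \<bullet> k) (e1 \<bullet> k) = e0 \<bullet> k) \<and>
    (\<forall>\<Gamma> k l. k \<in> hom C \<Gamma> E \<longrightarrow> l \<in> hom C \<Gamma> E \<longrightarrow> e0 \<bullet> k = e0 \<bullet> l \<longrightarrow> e1 \<bullet> k = e1 \<bullet> l \<longrightarrow> k = l) \<and>
    (\<forall>\<Gamma> a b. a \<in> hom C \<Gamma> (car L) \<longrightarrow> b \<in> hom C \<Gamma> (car L) \<longrightarrow> meet_at C L a b = a \<longrightarrow>
      (\<exists>k\<in>hom C \<Gamma> E. e0 \<bullet> k = a \<and> e1 \<bullet> k = b))"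

lemma ordered_pairsD:
  assumes "ordered_pairs L E e0 e1"
  shows "E \<in> Obj C" "e0 \<in> hom C E (car L)" "e1 \<in> hom C E (car L)"
    "\<And>\<Gamma> k. k \<in> hom C \<Gamma> E \<Longrightarrow> meet_at C L (e0 \<bullet> k) (e1 \<bullet> k) = e0 \<bullet> k"
    "\<And>\<Gamma> k l. k \<in> hom C \<Gamma> E \<Longrightarrow> l \<in> hom C \<Gamma> E \<Longrightarrow> e0 \<bullet> k = e0 \<bullet> l \<Longrightarrow> e1 \<bullet> k = e1 \<bullet> l \<Longrightarrow> k = l"
    "\<And>\<Gamma> a b. a \<in> hom C \<Gamma> (car L) \<Longrightarrow> b \<in> hom C \<Gamma> (car L) \<Longrightarrow> meet_at C L a b = a \<Longrightarrow>
      \<exists>k\<in>hom C \<Gamma> E. e0 \<bullet> k = a \<and> e1 \<bullet> k = b"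
  using assms unfolding ordered_pairs_def by blast+

text \<open>The condition \<open>a \<le> b\<close> is the equation \<open>a \<and> b = a\<close>, so
  the object is the equaliser of \<open>meet L\<close> and the first projection on
  \<open>L \<times> L\<close>.\<close>

lemma ordered_pairs_exist:
  assumes L: "internal_bdl C L"
  shows "\<exists>E e0 e1. ordered_pairs L E e0 e1"
proof -
  let ?P = "prod_obj C (car L) (car L)"
  have [simp]: "car L \<in> Obj C" using L by simp
  note [simp] = bdl_ops_type[OF L]
  have "\<exists>E\<in>Obj C. \<exists>e\<in>hom C E ?P. meet L \<bullet> e = proj1 C (car L) (car L) \<bullet> e \<and>
    (\<forall>W\<in>Obj C. \<forall>h\<in>hom C W ?P. meet L \<bullet> h = proj1 C (car L) (car L) \<bullet> h \<longrightarrow> (\<exists>!k. k \<in> hom C W E \<and> e \<bullet> k = h))"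
    by (rule equalizers) auto
  then obtain E e where E: "E \<in> Obj C" and e: "e \<in> hom C E ?P"
    and eq: "meet L \<bullet> e = proj1 C (car L) (car L) \<bullet> e"
    and univ: "\<And>W h. W \<in> Obj C \<Longrightarrow> h \<in> hom C W ?P \<Longrightarrow> meet L \<bullet> h = proj1 C (car L) (car L) \<bullet> h
      \<Longrightarrow> \<exists>!k. k \<in> hom C W E \<and> e \<bullet> k = h"
    by blast
  note [simp] = e[unfolded hom_iff] eq
  have meet: "meet_at C L (proj1 C (car L) (car L) \<bullet> h) (proj2 C (car L) (car L) \<bullet> h) = meet L \<bullet> h"
    if "h \<in> hom C W ?P" for W h
    using that by (simp add: meet_at_def tuple_eta)
  have eq': "meet L \<bullet> e \<bullet> k = proj1 C (car L) (car L) \<bullet> e \<bullet> k" if "k \<in> hom C \<Gamma> E" for k \<Gamma>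
    using that eq by (simp flip: comp_assoc' del: eq)
  have "ordered_pairs L E (proj1 C (car L) (car L) \<bullet> e) (proj2 C (car L) (car L) \<bullet> e)"
    unfolding ordered_pairs_def
  proof (intro conjI allI impI)
    show "E \<in> Obj C" by (fact E)
    show "proj1 C (car L) (car L) \<bullet> e \<in> hom C E (car L)" "proj2 C (car L) (car L) \<bullet> e \<in> hom C E (car L)"
      by auto
  next
    fix \<Gamma> k assume "k \<in> hom C \<Gamma> E"
    then show "meet_at C L ((proj1 C (car L) (car L) \<bullet> e) \<bullet> k) ((proj2 C (car L) (car L) \<bullet> e) \<bullet> k) =
       (proj1 C (car L) (car L) \<bullet> e) \<bullet> k"
      using meet[of "e \<bullet> k" \<Gamma>] eq' by simp
  next
    fix \<Gamma> k l assume k: "k \<in> hom C \<Gamma> E" and l: "l \<in> hom C \<Gamma> E"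
      and *: "(proj1 C (car L) (car L) \<bullet> e) \<bullet> k = (proj1 C (car L) (car L) \<bullet> e) \<bullet> l"
        "(proj2 C (car L) (car L) \<bullet> e) \<bullet> k = (proj2 C (car L) (car L) \<bullet> e) \<bullet> l"
    have "e \<bullet> k = e \<bullet> l"
      by (rule prod_ext[of "car L" "car L"]) (use k l * in auto)
    moreover have "\<exists>!k'. k' \<in> hom C \<Gamma> E \<and> e \<bullet> k' = e \<bullet> k"
      by (rule univ) (use k eq' in auto)
    ultimately show "k = l" using k l by metis
  next
    fix \<Gamma> a b assume *: "a \<in> hom C \<Gamma> (car L)" "b \<in> hom C \<Gamma> (car L)" "meet_at C L a b = a"
    have "\<exists>!k. k \<in> hom C \<Gamma> E \<and> e \<bullet> k = tuple C a b"
      by (rule univ) (use * in \<open>auto simp: meet_at_def\<close>)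
    then obtain k where "k \<in> hom C \<Gamma> E" "e \<bullet> k = tuple C a b" by blast
    then show "\<exists>k\<in>hom C \<Gamma> E. (proj1 C (car L) (car L) \<bullet> e) \<bullet> k = a \<and> (proj2 C (car L) (car L) \<bullet> e) \<bullet> k = b"
      using * by (intro bexI[of _ k]) auto
  qed
  then show ?thesis by blast
qed

text \<open>This is the concrete candidate for \<open>A[j]\<close>, with \<open>e0\<close> and
  \<open>e1\<close> as evaluation at 0 and 1. Componentwise operations stay among ordered pairs by
  monotonicity, the scalars lie on the diagonal, and all laws are inherited from \<open>A\<close>
  because \<open>e0\<close> and \<open>e1\<close> are jointly monic.\<close>

lemma ordered_pairs_alg:
  assumes I: "internal_bdl C I" and A: "internal_alg C I A"
  obtains B e0 e1 where "internal_alg C I B" "alg_hom C B A e0" "alg_hom C B A e1"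
    "ordered_pairs A (car B) e0 e1"
proof -
  have L: "internal_bdl C A" using A by (rule alg_bdl)
  note [simp] = I L str_type[OF A]
  have strhom: "bdl_hom C I A (str A)" using A by (simp add: internal_alg_def)
  obtain E e0 e1 where op: "ordered_pairs A E e0 e1"
    using ordered_pairs_exist[OF L] by blast
  note E = ordered_pairsD(1)[OF op] and e0 = ordered_pairsD(2)[OF op] and e1 = ordered_pairsD(3)[OF op]
    and le = ordered_pairsD(4)[OF op] and monic = ordered_pairsD(5)[OF op]
    and pair = ordered_pairsD(6)[OF op]
  note [simp] = E e0[unfolded hom_iff] e1[unfolded hom_iff]
  \<comment> \<open>Pairing as a total function: the stage is recovered as the domain of
    \<open>a\<close>, and the value is meaningful only if \<open>a \<le> b\<close>.\<close>
  define pr where "pr a b = (SOME k. k \<in> hom C (Dom C a) E \<and> e0 \<bullet> k = a \<and> e1 \<bullet> k = b)" for a b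
  have pr: "pr a b \<in> hom C \<Gamma> E \<and> e0 \<bullet> pr a b = a \<and> e1 \<bullet> pr a b = b"
    if "a \<in> hom C \<Gamma> (car A)" "b \<in> hom C \<Gamma> (car A)" "meet_at C A a b = a" for \<Gamma> a b
  proof -
    have d: "Dom C a = \<Gamma>" using that(1) by simp
    have "\<exists>k. k \<in> hom C \<Gamma> E \<and> e0 \<bullet> k = a \<and> e1 \<bullet> k = b"
      using pair[OF that] by blast
    from someI_ex[OF this] show ?thesis unfolding pr_def d .
  qed
  let ?E2 = "prod_obj C E E"
  \<comment> \<open>The two generic elements of \<open>E\<close>; an operation is fixed by its value
    on them, and other arguments follow by reindexing.\<close>
  define x y where "x = proj1 C E E" and "y = proj2 C E E"
  have xy: "x \<in> hom C ?E2 E" "y \<in> hom C ?E2 E" by (auto simp: x_def y_def)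
  note [simp] = xy[unfolded hom_iff]
  define B where "B = \<lparr>car = E,
      join = pr (join_at C A (e0 \<bullet> x) (e0 \<bullet> y)) (join_at C A (e1 \<bullet> x) (e1 \<bullet> y)),
      meet = pr (meet_at C A (e0 \<bullet> x) (e0 \<bullet> y)) (meet_at C A (e1 \<bullet> x) (e1 \<bullet> y)),
      bot = pr (bot_at C A (one C)) (bot_at C A (one C)),
      top = pr (top_at C A (one C)) (top_at C A (one C)),
      str = pr (str A) (str A)\<rparr>"
  have le_e: "meet_at C A (e0 \<bullet> x) (e1 \<bullet> x) = e0 \<bullet> x" "meet_at C A (e0 \<bullet> y) (e1 \<bullet> y) = e0 \<bullet> y"
    by (rule le[OF xy(1)], rule le[OF xy(2)])
  have [simp]: "?E2 \<in> Obj C" "one C \<in> Obj C" "car I \<in> Obj C" by auto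
  have join: "join B \<in> hom C ?E2 E \<and> e0 \<bullet> join B = join_at C A (e0 \<bullet> x) (e0 \<bullet> y)
      \<and> e1 \<bullet> join B = join_at C A (e1 \<bullet> x) (e1 \<bullet> y)"
    unfolding B_def bdl.simps by (rule pr) (auto intro!: order_at(1)[OF L, of ?E2] simp: le_e)
  have meet: "meet B \<in> hom C ?E2 E \<and> e0 \<bullet> meet B = meet_at C A (e0 \<bullet> x) (e0 \<bullet> y)
      \<and> e1 \<bullet> meet B = meet_at C A (e1 \<bullet> x) (e1 \<bullet> y)"
    unfolding B_def bdl.simps by (rule pr) (auto intro!: order_at(2)[OF L, of ?E2] simp: le_e)
  have bot: "bot B \<in> hom C (one C) E \<and> e0 \<bullet> bot B = bot_at C A (one C) \<and> e1 \<bullet> bot B = bot_at C A (one C)"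
    unfolding B_def bdl.simps by (rule pr) (auto intro!: order_at(3)[OF L, of "one C"])
  have top: "top B \<in> hom C (one C) E \<and> e0 \<bullet> top B = top_at C A (one C) \<and> e1 \<bullet> top B = top_at C A (one C)"
    unfolding B_def bdl.simps by (rule pr) (auto intro!: lattice_at(13)[OF L, of "one C"])
  have str: "str B \<in> hom C (car I) E \<and> e0 \<bullet> str B = str A \<and> e1 \<bullet> str B = str A"
    unfolding B_def alg.simps by (rule pr) (auto intro!: meet_idem_at[OF L, of "car I"])
  have car: "car B = E" by (simp add: B_def)
  have e_join: "e0 \<bullet> join_at C B k l = join_at C A (e0 \<bullet> k) (e0 \<bullet> l)"
     "e1 \<bullet> join_at C B k l = join_at C A (e1 \<bullet> k) (e1 \<bullet> l)"
     "e0 \<bullet> meet_at C B k l = meet_at C A (e0 \<bullet> k) (e0 \<bullet> l)"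
     "e1 \<bullet> meet_at C B k l = meet_at C A (e1 \<bullet> k) (e1 \<bullet> l)"
    if "k \<in> hom C \<Gamma> E" "l \<in> hom C \<Gamma> E" for \<Gamma> k l
  proof -
    have "(e0 \<bullet> join B) \<bullet> tuple C k l = join_at C A (e0 \<bullet> x) (e0 \<bullet> y) \<bullet> tuple C k l"
      "(e1 \<bullet> join B) \<bullet> tuple C k l = join_at C A (e1 \<bullet> x) (e1 \<bullet> y) \<bullet> tuple C k l"
      "(e0 \<bullet> meet B) \<bullet> tuple C k l = meet_at C A (e0 \<bullet> x) (e0 \<bullet> y) \<bullet> tuple C k l"
      "(e1 \<bullet> meet B) \<bullet> tuple C k l = meet_at C A (e1 \<bullet> x) (e1 \<bullet> y) \<bullet> tuple C k l"
      using join meet by simp_all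
    then show "e0 \<bullet> join_at C B k l = join_at C A (e0 \<bullet> k) (e0 \<bullet> l)"
     "e1 \<bullet> join_at C B k l = join_at C A (e1 \<bullet> k) (e1 \<bullet> l)"
     "e0 \<bullet> meet_at C B k l = meet_at C A (e0 \<bullet> k) (e0 \<bullet> l)"
     "e1 \<bullet> meet_at C B k l = meet_at C A (e1 \<bullet> k) (e1 \<bullet> l)"
      unfolding join_at_def[of C B] meet_at_def[of C B] using conjunct1[OF join] conjunct1[OF meet] that by (simp_all add: x_def y_def)
  qed
  have e_bot: "e0 \<bullet> bot_at C B \<Gamma> = bot_at C A \<Gamma>" "e1 \<bullet> bot_at C B \<Gamma> = bot_at C A \<Gamma>"
    "e0 \<bullet> top_at C B \<Gamma> = top_at C A \<Gamma>" "e1 \<bullet> top_at C B \<Gamma> = top_at C A \<Gamma>"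
    if "\<Gamma> \<in> Obj C" for \<Gamma>
  proof -
    have "(e0 \<bullet> bot B) \<bullet> bang C \<Gamma> = bot_at C A (one C) \<bullet> bang C \<Gamma>"
      "(e1 \<bullet> bot B) \<bullet> bang C \<Gamma> = bot_at C A (one C) \<bullet> bang C \<Gamma>"
      "(e0 \<bullet> top B) \<bullet> bang C \<Gamma> = top_at C A (one C) \<bullet> bang C \<Gamma>"
      "(e1 \<bullet> top B) \<bullet> bang C \<Gamma> = top_at C A (one C) \<bullet> bang C \<Gamma>"
      using bot top by simp_all
    then show "e0 \<bullet> bot_at C B \<Gamma> = bot_at C A \<Gamma>" "e1 \<bullet> bot_at C B \<Gamma> = bot_at C A \<Gamma>"
      "e0 \<bullet> top_at C B \<Gamma> = top_at C A \<Gamma>" "e1 \<bullet> top_at C B \<Gamma> = top_at C A \<Gamma>"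
      unfolding bot_at_def[of C B] top_at_def[of C B] using conjunct1[OF bot] conjunct1[OF top] L that by simp_all
  qed
  have bh: "bdl_hom C B A e0" "bdl_hom C B A e1"
    unfolding bdl_hom_def car using e0 e1 e_join e_bot by auto
  have B: "internal_bdl C B"
    by (rule internal_bdl_jointly_monic[OF L _ _ _ _ _ bh]; (rule monic)?;
        use join meet bot top car in auto)
  note e_str = conjunct1[OF conjunct2[OF str]] conjunct2[OF conjunct2[OF str]]
  have e_str_comp: "e0 \<bullet> str B \<bullet> i = str A \<bullet> i" "e1 \<bullet> str B \<bullet> i = str A \<bullet> i"
    if "i \<in> hom C \<Gamma> (car I)" for i \<Gamma>
  proof -
    have "(e0 \<bullet> str B) \<bullet> i = str A \<bullet> i" "(e1 \<bullet> str B) \<bullet> i = str A \<bullet> i"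
      using str by simp_all
    then show "e0 \<bullet> str B \<bullet> i = str A \<bullet> i" "e1 \<bullet> str B \<bullet> i = str A \<bullet> i"
      using that conjunct1[OF str] by simp_all
  qed
  note B' = at_type[OF B, unfolded car]
  have "bdl_hom C I B (str B)"
    unfolding bdl_hom_def car
    apply (intro conjI ballI)
    subgoal using str by simp
    subgoal for \<Gamma> a b by (rule monic[of _ \<Gamma>]) (use str in \<open>auto simp: B' e_str_comp[of _ \<Gamma>] e_join[of _ \<Gamma>] bdl_hom_at[OF strhom I]\<close>)
    subgoal for \<Gamma> a b by (rule monic[of _ \<Gamma>]) (use str in \<open>auto simp: B' e_str_comp[of _ \<Gamma>] e_join[of _ \<Gamma>] bdl_hom_at[OF strhom I]\<close>)
    subgoal for \<Gamma> a b by (rule monic[of _ \<Gamma>]) (use str in \<open>auto simp: B' e_str_comp[of _ \<Gamma>] e_bot[of \<Gamma>] bdl_hom_at[OF strhom I]\<close>)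
    subgoal for \<Gamma> a b by (rule monic[of _ \<Gamma>]) (use str in \<open>auto simp: B' e_str_comp[of _ \<Gamma>] e_bot[of \<Gamma>] bdl_hom_at[OF strhom I]\<close>)
    done
  then have "internal_alg C I B" using B by (simp add: internal_alg_def)
  moreover have "alg_hom C B A e0" "alg_hom C B A e1"
    using bh e_str by (simp_all add: alg_hom_def)
  ultimately show ?thesis using that[of B e0 e1] op unfolding car by blast
qed

text \<open>Interpolation at a fixed point \<open>c\<close> between homomorphisms
  \<open>f0 \<le> f1\<close>. The order enters for meets only; bounds and scalars are preserved
  because \<open>f0\<close> and \<open>f1\<close> agree on them.\<close>

lemma alg_hom_mix:
  assumes B: "internal_alg C I B" and P: "internal_alg C I P"
    and c: "c \<in> hom C (one C) (car P)"
    and f: "alg_hom C B P f0" "alg_hom C B P f1"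
    and le: "\<And>\<Gamma> k. k \<in> hom C \<Gamma> (car B) \<Longrightarrow> meet_at C P (f0 \<bullet> k) (f1 \<bullet> k) = f0 \<bullet> k"
  shows "alg_hom C B P (mix_at P (c \<bullet> bang C (car B)) f0 f1)"
proof -
  note [simp] = alg_bdl[OF B] alg_bdl[OF P] c[unfolded hom_iff] str_type[OF B] str_type[OF P]
    bdl_hom_type[OF alg_hom_bdl[OF f(1)]] bdl_hom_type[OF alg_hom_bdl[OF f(2)]]
    bdl_hom_at[OF alg_hom_bdl[OF f(1)] alg_bdl[OF B]] bdl_hom_at[OF alg_hom_bdl[OF f(2)] alg_bdl[OF B]]
    alg_hom_str[OF f(1)] alg_hom_str[OF f(2)]
  have [simp]: "car I \<in> Obj C" using str_type[OF B] dom_obj by metis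
  note mix = mix_at[OF alg_bdl[OF P]]
  have "mix_at P (c \<bullet> bang C \<Gamma>) (bot_at C P \<Gamma>) (bot_at C P \<Gamma>) = bot_at C P \<Gamma>"
    "mix_at P (c \<bullet> bang C \<Gamma>) (top_at C P \<Gamma>) (top_at C P \<Gamma>) = top_at C P \<Gamma>" if "\<Gamma> \<in> Obj C" for \<Gamma>
    using that by (auto intro!: mix(3)[of \<Gamma>])
  moreover have "mix_at P (c \<bullet> bang C \<Gamma>) (join_at C P (f0 \<bullet> a) (f0 \<bullet> b)) (join_at C P (f1 \<bullet> a) (f1 \<bullet> b)) =
      join_at C P (mix_at P (c \<bullet> bang C \<Gamma>) (f0 \<bullet> a) (f1 \<bullet> a)) (mix_at P (c \<bullet> bang C \<Gamma>) (f0 \<bullet> b) (f1 \<bullet> b))"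
     "mix_at P (c \<bullet> bang C \<Gamma>) (meet_at C P (f0 \<bullet> a) (f0 \<bullet> b)) (meet_at C P (f1 \<bullet> a) (f1 \<bullet> b)) =
      meet_at C P (mix_at P (c \<bullet> bang C \<Gamma>) (f0 \<bullet> a) (f1 \<bullet> a)) (mix_at P (c \<bullet> bang C \<Gamma>) (f0 \<bullet> b) (f1 \<bullet> b))"
    if "\<Gamma> \<in> Obj C" "a \<in> hom C \<Gamma> (car B)" "b \<in> hom C \<Gamma> (car B)" for \<Gamma> a b
    using that le[OF that(2)] le[OF that(3)] by (auto intro!: mix(1,2)[of \<Gamma>])
  moreover have "mix_at P (c \<bullet> bang C (car I)) (str P) (str P) = str P"
    by (rule mix(3)[of "car I"]) auto
  ultimately show ?thesis
    unfolding alg_hom_def bdl_hom_def by auto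
qed

end

text \<open>The interface through which \<open>P\<close>, playing \<open>A[j]\<close>, is used from
  here on. Unlike freeness, these facts are about arrows and apply to elements \<open>p\<close> at
  any stage: \<open>e0\<close> and \<open>e1\<close> evaluate at 0 and 1, and \<open>decomp\<close>
  is the normal form.\<close>

locale poly_coords = fin_complete_ccc +
  fixes I :: "('a, 'b) bdl" and A P :: "('a, 'b) alg" and u j e0 e1 :: 'b
  assumes I: "internal_bdl C I" and A: "internal_alg C I A" and P: "internal_alg C I P"
    and u: "alg_hom C A P u" and j: "j \<in> hom C (one C) (car P)"
    and e0: "alg_hom C P A e0" and e1: "alg_hom C P A e1"
    and e0_u: "e0 \<bullet> u = ident C (car A)" and e1_u: "e1 \<bullet> u = ident C (car A)"
    and e0_j: "e0 \<bullet> j = bot_at C A (one C)" and e1_j: "e1 \<bullet> j = top_at C A (one C)"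
    and e0_le_e1: "p \<in> hom C \<Gamma> (car P) \<Longrightarrow> meet_at C A (e0 \<bullet> p) (e1 \<bullet> p) = e0 \<bullet> p"
    and decomp: "p \<in> hom C \<Gamma> (car P) \<Longrightarrow>
      join_at C P (u \<bullet> e0 \<bullet> p) (meet_at C P (j \<bullet> bang C \<Gamma>) (u \<bullet> e1 \<bullet> p)) = p"

context fin_complete_ccc
begin

text \<open>Existence in the universal property gives \<open>g\<close> from \<open>P\<close> to the
  algebra of ordered pairs, and the coordinates are its two components. Uniqueness is what makes
  them determine the polynomial.\<close>

lemma poly_coords_exist:
  assumes I: "internal_bdl C I" and A: "internal_alg C I A" and poly: "poly_alg C I A P u j"
  shows "\<exists>e0 e1. poly_coords C I A P u j e0 e1"
proof -
  from poly have P: "internal_alg C I P" and u: "alg_hom C A P u" and j: "j \<in> hom C (one C) (car P)"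
    and univ: "\<And>B f b. internal_alg C I B \<Longrightarrow> alg_hom C A B f \<Longrightarrow> b \<in> hom C (one C) (car B) \<Longrightarrow>
        \<exists>!g. alg_hom C P B g \<and> g \<bullet> u = f \<and> g \<bullet> j = b"
    unfolding poly_alg_def by blast+
  obtain B d0 d1 where B: "internal_alg C I B" and d0: "alg_hom C B A d0" and d1: "alg_hom C B A d1"
    and op: "ordered_pairs A (car B) d0 d1"
    by (rule ordered_pairs_alg[OF I A])
  note le = ordered_pairsD(4)[OF op] and monic = ordered_pairsD(5)[OF op]
  note bdls = alg_bdl[OF A] alg_bdl[OF B] alg_bdl[OF P]
  note [simp] = I bdls str_type[OF A] str_type[OF B] str_type[OF P] j[unfolded hom_iff]
    bdl_hom_type[OF alg_hom_bdl[OF u]] bdl_hom_type[OF alg_hom_bdl[OF d0]] bdl_hom_type[OF alg_hom_bdl[OF d1]]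
    bdl_hom_at[OF alg_hom_bdl[OF u] bdls(1)]
    bdl_hom_at[OF alg_hom_bdl[OF d0] bdls(2)] bdl_hom_at[OF alg_hom_bdl[OF d1] bdls(2)]
    alg_hom_str[OF u] alg_hom_str[OF d0] alg_hom_str[OF d1]
  \<comment> \<open>The diagonal \<open>a \<mapsto> (a, a)\<close>, the intended image of the
    constants.\<close>
  have "\<exists>k\<in>hom C (car A) (car B). d0 \<bullet> k = ident C (car A) \<and> d1 \<bullet> k = ident C (car A)"
    by (rule ordered_pairsD(6)[OF op]) (auto intro!: meet_idem_at[of _ "car A"])
  then obtain v where v: "v \<in> hom C (car A) (car B)" and dv: "d0 \<bullet> v = ident C (car A)" "d1 \<bullet> v = ident C (car A)"
    by blast
  \<comment> \<open>The pair \<open>(0, 1)\<close>, the intended image of the generator.\<close>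
  have "\<exists>k\<in>hom C (one C) (car B). d0 \<bullet> k = bot_at C A (one C) \<and> d1 \<bullet> k = top_at C A (one C)"
    by (rule ordered_pairsD(6)[OF op]) (auto intro!: order_at(3)[of _ "one C"])
  then obtain l where l: "l \<in> hom C (one C) (car B)" and dl: "d0 \<bullet> l = bot_at C A (one C)" "d1 \<bullet> l = top_at C A (one C)"
    by blast
  note [simp] = v[unfolded hom_iff] l[unfolded hom_iff]
  have dv': "d0 \<bullet> v \<bullet> a = a" "d1 \<bullet> v \<bullet> a = a" if "a \<in> Arr C" "Cod C a = car A" for a
  proof -
    have "(d0 \<bullet> v) \<bullet> a = a" "(d1 \<bullet> v) \<bullet> a = a" using that unfolding dv by simp_all
    then show "d0 \<bullet> v \<bullet> a = a" "d1 \<bullet> v \<bullet> a = a" using that by simp_all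
  qed
  have "bdl_hom C A B v"
    unfolding bdl_hom_def
    by (intro conjI ballI; (rule monic)?) (auto simp: dv')
  moreover have "v \<bullet> str A = str B"
    by (rule monic[of _ "car I"]) (auto simp: dv')
  ultimately have v_hom: "alg_hom C A B v" by (simp add: alg_hom_def)
  obtain g where g: "alg_hom C P B g" and gu: "g \<bullet> u = v" and gj: "g \<bullet> j = l"
    using univ[OF B v_hom l] by blast
  note [simp] = bdl_hom_type[OF alg_hom_bdl[OF g]]
  have le_u: "meet_at C P ((u \<bullet> d0) \<bullet> k) ((u \<bullet> d1) \<bullet> k) = (u \<bullet> d0) \<bullet> k" if "k \<in> hom C \<Gamma> (car B)" for \<Gamma> k
  proof -
    have "u \<bullet> meet_at C A (d0 \<bullet> k) (d1 \<bullet> k) = u \<bullet> d0 \<bullet> k" using le[OF that] by simp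
    with that show ?thesis by simp
  qed
  \<comment> \<open>\<open>h\<close> retracts \<open>g\<close>, which gives the normal form\<close>
  define h where "h = mix_at P (j \<bullet> bang C (car B)) (u \<bullet> d0) (u \<bullet> d1)"
  have h: "alg_hom C B P h"
    unfolding h_def
    by (rule alg_hom_mix[OF B P j alg_hom_comp[OF B A d0 u] alg_hom_comp[OF B A d1 u] le_u])
  note [simp] = bdl_hom_type[OF alg_hom_bdl[OF h]]
  have h_app: "h \<bullet> k = mix_at P (j \<bullet> bang C \<Gamma>) (u \<bullet> d0 \<bullet> k) (u \<bullet> d1 \<bullet> k)" if "k \<in> hom C \<Gamma> (car B)" for \<Gamma> k
    using that by (simp add: h_def)
  have "h \<bullet> v = u"
    using h_app[OF v] by (simp add: dv) (rule mix_at(3)[OF bdls(3), of "car A"]; simp)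
  moreover have "h \<bullet> l = j"
    using h_app[OF l] by (simp add: dl) (rule mix_at(6)[OF bdls(3), of "one C"]; simp)
  \<comment> \<open>Both \<open>h \<bullet> g\<close> and the identity restrict to \<open>u\<close>
    along \<open>u\<close> and fix \<open>j\<close>, so uniqueness for maps from \<open>P\<close> to
    itself identifies them.\<close>
  ultimately have hg: "h \<bullet> g = ident C (car P)"
    using univ[OF P u j] alg_hom_comp[OF P B g h] alg_hom_ident[OF P] gu gj
    by (metis comp_assoc' ident_left' bdl_hom_type[OF alg_hom_bdl[OF u]] bdl_hom_type[OF alg_hom_bdl[OF g]]
        bdl_hom_type[OF alg_hom_bdl[OF h]] j hom_iff)
  have "poly_coords C I A P u j (d0 \<bullet> g) (d1 \<bullet> g)"
  proof (intro poly_coords.intro poly_coords_axioms.intro)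
    show "fin_complete_ccc C" by (fact fin_complete_ccc_axioms)
    show "alg_hom C P A (d0 \<bullet> g)" "alg_hom C P A (d1 \<bullet> g)"
      by (rule alg_hom_comp[OF P B g d0], rule alg_hom_comp[OF P B g d1])
    show "(d0 \<bullet> g) \<bullet> u = ident C (car A)" "(d1 \<bullet> g) \<bullet> u = ident C (car A)"
      using dv by (simp_all add: gu)
    show "(d0 \<bullet> g) \<bullet> j = bot_at C A (one C)" "(d1 \<bullet> g) \<bullet> j = top_at C A (one C)"
      using dl by (simp_all add: gj)
  next
    fix p \<Gamma> assume p: "p \<in> hom C \<Gamma> (car P)"
    then have gp: "g \<bullet> p \<in> hom C \<Gamma> (car B)" by simp
    from le[OF this] p show "meet_at C A ((d0 \<bullet> g) \<bullet> p) ((d1 \<bullet> g) \<bullet> p) = (d0 \<bullet> g) \<bullet> p"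
      by simp
    have "p = (h \<bullet> g) \<bullet> p" using p unfolding hg by simp
    also have "\<dots> = h \<bullet> g \<bullet> p" using p by simp
    also note h_app[OF gp]
    finally show "join_at C P (u \<bullet> (d0 \<bullet> g) \<bullet> p) (meet_at C P (j \<bullet> bang C \<Gamma>) (u \<bullet> (d1 \<bullet> g) \<bullet> p)) = p"
      using p by (simp add: mix_at_def)
  qed (fact I A P u j)+
  then show ?thesis by blast
qed

section \<open>Spectra and the evaluation map\<close>

lemma base_alg_at [simp]:
  "car (base_alg C I) = car I" "str (base_alg C I) = ident C (car I)"
  "join_at C (base_alg C I) = join_at C I" "meet_at C (base_alg C I) = meet_at C I"
  "bot_at C (base_alg C I) = bot_at C I" "top_at C (base_alg C I) = top_at C I"
  by (auto simp: base_alg_def join_at_def meet_at_def bot_at_def top_at_def fun_eq_iff)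

lemma hom_at_type:
  assumes "hom_at C I A (base_alg C I) \<Gamma> x"
  shows "x \<in> Arr C" "Dom C x = \<Gamma>" "Cod C x = exp_obj C (car A) (car I)"
  using assms by (auto simp: hom_at_def)

text \<open>\<open>hom_at\<close> already quantifies over all later stages, so only associativity is
  at stake.\<close>

lemma hom_at_comp:
  assumes x: "hom_at C I A (base_alg C I) \<Gamma> x" and s: "s \<in> hom C \<Delta> \<Gamma>"
  shows "hom_at C I A (base_alg C I) \<Delta> (x \<bullet> s)"
  unfolding hom_at_def
proof (intro conjI ballI)
  show "x \<bullet> s \<in> hom C \<Delta> (exp_obj C (car A) (car (base_alg C I)))"
    using hom_at_type[OF x] s by simp
next
  fix \<Delta>' t assume t: "\<Delta>' \<in> Obj C" "t \<in> hom C \<Delta>' \<Delta>"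
  then have st: "s \<bullet> t \<in> hom C \<Delta>' \<Gamma>" and eq: "(x \<bullet> s) \<bullet> t = x \<bullet> s \<bullet> t"
    using hom_at_type[OF x] s by simp_all
  from x have "\<forall>\<Delta>\<in>Obj C. \<forall>s\<in>hom C \<Delta> \<Gamma>.
        let h = app C (car A) (car (base_alg C I)) (x \<bullet> s) in
        (\<forall>a\<in>hom C \<Delta> (car A). \<forall>b\<in>hom C \<Delta> (car A).
           h (join_at C A a b) = join_at C (base_alg C I) (h a) (h b) \<and>
           h (meet_at C A a b) = meet_at C (base_alg C I) (h a) (h b)) \<and>
        h (bot_at C A \<Delta>) = bot_at C (base_alg C I) \<Delta> \<and>
        h (top_at C A \<Delta>) = top_at C (base_alg C I) \<Delta> \<and>
        (\<forall>i\<in>hom C \<Delta> (car I). h (str A \<bullet> i) = str (base_alg C I) \<bullet> i)"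
    unfolding hom_at_def by (rule conjunct2)
  from bspec[OF bspec[OF this t(1)] st]
  show "let h = app C (car A) (car (base_alg C I)) ((x \<bullet> s) \<bullet> t) in
        (\<forall>a\<in>hom C \<Delta>' (car A). \<forall>b\<in>hom C \<Delta>' (car A).
           h (join_at C A a b) = join_at C (base_alg C I) (h a) (h b) \<and>
           h (meet_at C A a b) = meet_at C (base_alg C I) (h a) (h b)) \<and>
        h (bot_at C A \<Delta>') = bot_at C (base_alg C I) \<Delta>' \<and>
        h (top_at C A \<Delta>') = top_at C (base_alg C I) \<Delta>' \<and>
        (\<forall>i\<in>hom C \<Delta>' (car I). h (str A \<bullet> i) = str (base_alg C I) \<bullet> i)"
    unfolding eq .
qed

text \<open>The case of the identity substitution; together with \<open>hom_at_comp\<close> it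
  serves every later stage.\<close>

lemma hom_at_app:
  assumes x: "hom_at C I A (base_alg C I) \<Gamma> x"
  shows "\<lbrakk>a \<in> Arr C; b \<in> Arr C; Dom C a = \<Gamma>; Dom C b = \<Gamma>; Cod C a = car A; Cod C b = car A\<rbrakk> \<Longrightarrow>
      app C (car A) (car I) x (join_at C A a b) = join_at C I (app C (car A) (car I) x a) (app C (car A) (car I) x b)"
    "\<lbrakk>a \<in> Arr C; b \<in> Arr C; Dom C a = \<Gamma>; Dom C b = \<Gamma>; Cod C a = car A; Cod C b = car A\<rbrakk> \<Longrightarrow>
      app C (car A) (car I) x (meet_at C A a b) = meet_at C I (app C (car A) (car I) x a) (app C (car A) (car I) x b)"
    "app C (car A) (car I) x (bot_at C A \<Gamma>) = bot_at C I \<Gamma>"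
    "app C (car A) (car I) x (top_at C A \<Gamma>) = top_at C I \<Gamma>"
    "i \<in> Arr C \<Longrightarrow> Dom C i = \<Gamma> \<Longrightarrow> Cod C i = car I \<Longrightarrow> app C (car A) (car I) x (str A \<bullet> i) = i"
proof -
  have \<Gamma>: "\<Gamma> \<in> Obj C" using hom_at_type[OF x] by auto
  then have "ident C \<Gamma> \<in> hom C \<Gamma> \<Gamma>" and [simp]: "x \<bullet> ident C \<Gamma> = x" using hom_at_type[OF x] by simp_all
  with \<Gamma> x[unfolded hom_at_def]
  have *: "let h = app C (car A) (car (base_alg C I)) (x \<bullet> ident C \<Gamma>) in
        (\<forall>a\<in>hom C \<Gamma> (car A). \<forall>b\<in>hom C \<Gamma> (car A).
           h (join_at C A a b) = join_at C (base_alg C I) (h a) (h b) \<and>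
           h (meet_at C A a b) = meet_at C (base_alg C I) (h a) (h b)) \<and>
        h (bot_at C A \<Gamma>) = bot_at C (base_alg C I) \<Gamma> \<and>
        h (top_at C A \<Gamma>) = top_at C (base_alg C I) \<Gamma> \<and>
        (\<forall>i\<in>hom C \<Gamma> (car I). h (str A \<bullet> i) = str (base_alg C I) \<bullet> i)"
    by blast
  show "\<lbrakk>a \<in> Arr C; b \<in> Arr C; Dom C a = \<Gamma>; Dom C b = \<Gamma>; Cod C a = car A; Cod C b = car A\<rbrakk> \<Longrightarrow>
      app C (car A) (car I) x (join_at C A a b) = join_at C I (app C (car A) (car I) x a) (app C (car A) (car I) x b)"
    "\<lbrakk>a \<in> Arr C; b \<in> Arr C; Dom C a = \<Gamma>; Dom C b = \<Gamma>; Cod C a = car A; Cod C b = car A\<rbrakk> \<Longrightarrow>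
      app C (car A) (car I) x (meet_at C A a b) = meet_at C I (app C (car A) (car I) x a) (app C (car A) (car I) x b)"
    "app C (car A) (car I) x (bot_at C A \<Gamma>) = bot_at C I \<Gamma>"
    "app C (car A) (car I) x (top_at C A \<Gamma>) = top_at C I \<Gamma>"
    "i \<in> Arr C \<Longrightarrow> Dom C i = \<Gamma> \<Longrightarrow> Cod C i = car I \<Longrightarrow> app C (car A) (car I) x (str A \<bullet> i) = i"
    using * by (auto simp: Let_def)
qed

lemma hom_at_mix:
  assumes "hom_at C I A (base_alg C I) \<Gamma> x" "internal_bdl C A" "a \<in> Arr C" "b \<in> Arr C" "c \<in> Arr C"
    "Dom C a = \<Gamma>" "Dom C b = \<Gamma>" "Dom C c = \<Gamma>" "Cod C a = car A" "Cod C b = car A" "Cod C c = car A"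
  shows "app C (car A) (car I) x (mix_at A c a b) =
    mix_at I (app C (car A) (car I) x c) (app C (car A) (car I) x a) (app C (car A) (car I) x b)"
  using assms by (simp add: mix_at_def hom_at_app)

lemma hom_atI:
  assumes "x \<in> hom C \<Gamma> (exp_obj C (car A) (car I))"
    and "\<And>\<Delta> s a b. \<lbrakk>\<Delta> \<in> Obj C; s \<in> hom C \<Delta> \<Gamma>; a \<in> hom C \<Delta> (car A); b \<in> hom C \<Delta> (car A)\<rbrakk> \<Longrightarrow>
      app C (car A) (car I) (x \<bullet> s) (join_at C A a b)
        = join_at C I (app C (car A) (car I) (x \<bullet> s) a) (app C (car A) (car I) (x \<bullet> s) b)"
    and "\<And>\<Delta> s a b. \<lbrakk>\<Delta> \<in> Obj C; s \<in> hom C \<Delta> \<Gamma>; a \<in> hom C \<Delta> (car A); b \<in> hom C \<Delta> (car A)\<rbrakk> \<Longrightarrow>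
      app C (car A) (car I) (x \<bullet> s) (meet_at C A a b)
        = meet_at C I (app C (car A) (car I) (x \<bullet> s) a) (app C (car A) (car I) (x \<bullet> s) b)"
    and "\<And>\<Delta> s. \<lbrakk>\<Delta> \<in> Obj C; s \<in> hom C \<Delta> \<Gamma>\<rbrakk> \<Longrightarrow> app C (car A) (car I) (x \<bullet> s) (bot_at C A \<Delta>) = bot_at C I \<Delta>"
    and "\<And>\<Delta> s. \<lbrakk>\<Delta> \<in> Obj C; s \<in> hom C \<Delta> \<Gamma>\<rbrakk> \<Longrightarrow> app C (car A) (car I) (x \<bullet> s) (top_at C A \<Delta>) = top_at C I \<Delta>"
    and "\<And>\<Delta> s i. \<lbrakk>\<Delta> \<in> Obj C; s \<in> hom C \<Delta> \<Gamma>; i \<in> hom C \<Delta> (car I)\<rbrakk> \<Longrightarrow> app C (car A) (car I) (x \<bullet> s) (str A \<bullet> i) = i"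
  shows "hom_at C I A (base_alg C I) \<Gamma> x"
  unfolding hom_at_def Let_def base_alg_at
  by (intro conjI ballI assms; (simp only: hom_iff ident_left' assms(6)[simplified])?)

lemma is_SpecD:
  assumes "is_Spec C I A S m"
  shows "S \<in> Obj C" "m \<in> Arr C" "Dom C m = S" "Cod C m = exp_obj C (car A) (car I)"
    "y \<in> hom C \<Gamma> S \<Longrightarrow> hom_at C I A (base_alg C I) \<Gamma> (m \<bullet> y)"
    "y \<in> hom C \<Gamma> S \<Longrightarrow> y' \<in> hom C \<Gamma> S \<Longrightarrow> m \<bullet> y = m \<bullet> y' \<Longrightarrow> y = y'"
    "hom_at C I A (base_alg C I) \<Gamma> x \<Longrightarrow> \<exists>y\<in>hom C \<Gamma> S. m \<bullet> y = x"
proof -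
  show "S \<in> Obj C" "m \<in> Arr C" "Dom C m = S" "Cod C m = exp_obj C (car A) (car I)"
    using assms by (auto simp: is_Spec_def hom_object_def)
  have bij: "bij_betw (\<lambda>y. m \<bullet> y) (hom C \<Gamma> S) {x. hom_at C I A (base_alg C I) \<Gamma> x}" if "\<Gamma> \<in> Obj C" for \<Gamma>
    using assms that by (auto simp: is_Spec_def hom_object_def)
  show "hom_at C I A (base_alg C I) \<Gamma> (m \<bullet> y)" if y: "y \<in> hom C \<Gamma> S"
  proof -
    have "\<Gamma> \<in> Obj C" using y by auto
    from bij_betwE[OF bij[OF this]] y show ?thesis by blast
  qed
  show "y = y'" if y: "y \<in> hom C \<Gamma> S" "y' \<in> hom C \<Gamma> S" "m \<bullet> y = m \<bullet> y'"
  proof -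
    have "\<Gamma> \<in> Obj C" using y by auto
    from bij_betw_imp_inj_on[OF bij[OF this]] y show ?thesis by (blast dest: inj_onD)
  qed
  show "\<exists>y\<in>hom C \<Gamma> S. m \<bullet> y = x" if x: "hom_at C I A (base_alg C I) \<Gamma> x"
  proof -
    have "\<Gamma> \<in> Obj C" using hom_at_type[OF x] by auto
    from bij_betw_imp_surj_on[OF bij[OF this]] x show ?thesis by (blast dest: equalityD2)
  qed
qed

lemma Spec_app:
  assumes "is_Spec C I A S m" "y \<in> Arr C" "Cod C y = S"
  shows "\<lbrakk>a \<in> Arr C; b \<in> Arr C; Dom C a = Dom C y; Dom C b = Dom C y; Cod C a = car A; Cod C b = car A\<rbrakk> \<Longrightarrow>
      app C (car A) (car I) (m \<bullet> y) (join_at C A a b)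
        = join_at C I (app C (car A) (car I) (m \<bullet> y) a) (app C (car A) (car I) (m \<bullet> y) b)"
    "\<lbrakk>a \<in> Arr C; b \<in> Arr C; Dom C a = Dom C y; Dom C b = Dom C y; Cod C a = car A; Cod C b = car A\<rbrakk> \<Longrightarrow>
      app C (car A) (car I) (m \<bullet> y) (meet_at C A a b)
        = meet_at C I (app C (car A) (car I) (m \<bullet> y) a) (app C (car A) (car I) (m \<bullet> y) b)"
    "Dom C y = \<Gamma> \<Longrightarrow> app C (car A) (car I) (m \<bullet> y) (bot_at C A \<Gamma>) = bot_at C I \<Gamma>"
    "Dom C y = \<Gamma> \<Longrightarrow> app C (car A) (car I) (m \<bullet> y) (top_at C A \<Gamma>) = top_at C I \<Gamma>"
    "i \<in> Arr C \<Longrightarrow> Dom C i = Dom C y \<Longrightarrow> Cod C i = car I \<Longrightarrow> app C (car A) (car I) (m \<bullet> y) (str A \<bullet> i) = i"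
  using hom_at_app[OF is_SpecD(5)[OF assms(1), of y "Dom C y"]] assms(2,3) by simp_all

lemma is_SpecI:
  assumes "S \<in> Obj C" "m \<in> hom C S (exp_obj C (car A) (car I))"
    and "\<And>\<Gamma> y. y \<in> hom C \<Gamma> S \<Longrightarrow> hom_at C I A (base_alg C I) \<Gamma> (m \<bullet> y)"
    and "\<And>\<Gamma> y y'. y \<in> hom C \<Gamma> S \<Longrightarrow> y' \<in> hom C \<Gamma> S \<Longrightarrow> m \<bullet> y = m \<bullet> y' \<Longrightarrow> y = y'"
    and "\<And>\<Gamma> x. hom_at C I A (base_alg C I) \<Gamma> x \<Longrightarrow> \<exists>y\<in>hom C \<Gamma> S. m \<bullet> y = x"
  shows "is_Spec C I A S m"
  unfolding is_Spec_def hom_object_def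
proof (intro conjI ballI bij_betw_imageI inj_onI)
  show "S \<in> Obj C" "m \<in> hom C S (exp_obj C (car A) (car (base_alg C I)))" using assms(1,2) by simp_all
next
  fix \<Gamma> y y' assume "y \<in> hom C \<Gamma> S" "y' \<in> hom C \<Gamma> S" "m \<bullet> y = m \<bullet> y'"
  then show "y = y'" by (rule assms(4))
next
  fix \<Gamma> show "(\<lambda>y. m \<bullet> y) ` hom C \<Gamma> S = {x. hom_at C I A (base_alg C I) \<Gamma> x}"
    by (rule set_eqI, rule iffI) (use assms(3,5) in blast)+
qed

lemma fun_alg_sel:
  "car (fun_alg C I X) = exp_obj C X (car I)"
  by (simp add: fun_alg_def Let_def)

lemma fun_alg_ops_type:
  assumes "internal_bdl C I" "X \<in> Obj C"
  shows "join (fun_alg C I X) \<in> hom C (prod_obj C (exp_obj C X (car I)) (exp_obj C X (car I))) (exp_obj C X (car I))"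
    "meet (fun_alg C I X) \<in> hom C (prod_obj C (exp_obj C X (car I)) (exp_obj C X (car I))) (exp_obj C X (car I))"
    "bot (fun_alg C I X) \<in> hom C (one C) (exp_obj C X (car I))"
    "top (fun_alg C I X) \<in> hom C (one C) (exp_obj C X (car I))"
    "str (fun_alg C I X) \<in> hom C (car I) (exp_obj C X (car I))"
  using assms by (simp_all add: fun_alg_def Let_def)

lemma fun_alg_app:
  assumes "internal_bdl C I" "x \<in> Arr C" "Cod C x = X"
  shows "\<lbrakk>f \<in> Arr C; g \<in> Arr C; Dom C f = Dom C x; Dom C g = Dom C x; Cod C f = exp_obj C X (car I); Cod C g = exp_obj C X (car I)\<rbrakk> \<Longrightarrow>
     app C X (car I) (join (fun_alg C I X) \<bullet> tuple C f g) x = join_at C I (app C X (car I) f x) (app C X (car I) g x)"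
    "\<lbrakk>f \<in> Arr C; g \<in> Arr C; Dom C f = Dom C x; Dom C g = Dom C x; Cod C f = exp_obj C X (car I); Cod C g = exp_obj C X (car I)\<rbrakk> \<Longrightarrow>
     app C X (car I) (meet (fun_alg C I X) \<bullet> tuple C f g) x = meet_at C I (app C X (car I) f x) (app C X (car I) g x)"
    "Dom C x = \<Gamma> \<Longrightarrow> app C X (car I) (bot (fun_alg C I X) \<bullet> bang C \<Gamma>) x = bot_at C I \<Gamma>"
    "Dom C x = \<Gamma> \<Longrightarrow> app C X (car I) (top (fun_alg C I X) \<bullet> bang C \<Gamma>) x = top_at C I \<Gamma>"
    "\<lbrakk>i \<in> Arr C; Dom C i = Dom C x; Cod C i = car I\<rbrakk> \<Longrightarrow> app C X (car I) (str (fun_alg C I X) \<bullet> i) x = i"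
  using assms cod_obj[of x] dom_obj[of x] by (simp_all add: fun_alg_def Let_def)

lemma iota_type:
  assumes "internal_bdl C I" "internal_bdl C A" "is_Spec C I A S m"
  shows "iota C I A S m \<in> hom C (car A) (exp_obj C S (car I))"
  using assms is_SpecD(1-4)[OF assms(3)] by (simp add: iota_def)

lemma app_iota:
  assumes "internal_bdl C I" "internal_bdl C A" "is_Spec C I A S m" "a \<in> Arr C" "y \<in> Arr C"
    "Dom C a = Dom C y" "Cod C a = car A" "Cod C y = S"
  shows "app C S (car I) (iota C I A S m \<bullet> a) y = app C (car A) (car I) (m \<bullet> y) a"
  using assms is_SpecD(1-4)[OF assms(3)] by (simp add: iota_def)

text \<open>Evaluated at a point \<open>y\<close> of the spectrum, each equation says that
  \<open>y\<close> itself is a homomorphism; extensionality does the rest.\<close>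

lemma iota_hom:
  assumes I: "internal_bdl C I" and A: "internal_alg C I A" and Spec: "is_Spec C I A S m"
  shows "alg_hom C A (fun_alg C I S) (iota C I A S m)"
proof -
  let ?E = "exp_obj C S (car I)" and ?F = "fun_alg C I S"
  note L = alg_bdl[OF A]
  note [simp] = I L str_type[OF A] is_SpecD(1-4)[OF Spec] app_iota[OF I L Spec] fun_alg_sel
    fun_alg_ops_type[OF I is_SpecD(1)[OF Spec], unfolded hom_iff]
    iota_type[OF I L Spec, unfolded hom_iff] fun_alg_app[OF I]
    Spec_app[OF Spec]
  have iota_ext: "f = g"
    if "f \<in> Arr C" "g \<in> Arr C" "Dom C g = Dom C f" "Cod C f = ?E" "Cod C g = ?E"
     "\<And>s y. \<lbrakk>s \<in> Arr C; Cod C s = Dom C f; y \<in> Arr C; Dom C y = Dom C s; Cod C y = S\<rbrakk> \<Longrightarrow>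
       app C S (car I) (f \<bullet> s) y = app C S (car I) (g \<bullet> s) y" for f g
    by (rule exp_ext[where X = S and Y = "car I" and \<Gamma> = "Dom C f"]) (use that in auto)
  show ?thesis
    unfolding alg_hom_def bdl_hom_def
    by (intro conjI ballI; (rule iota_ext)?)
       (simp_all add: join_at_def[of C ?F] meet_at_def[of C ?F] bot_at_def[of C ?F] top_at_def[of C ?F])
qed

text \<open>By Yoneda, bijectivity on elements at all stages suffices: a preimage of the generic
  element \<open>ident C (car B)\<close> is an inverse arrow. It preserves the operations because
  each equation may be checked after applying \<open>f\<close>.\<close>

lemma alg_isoI:
  assumes A: "internal_bdl C A" and str: "str A \<in> hom C X (car A)" and B: "car B \<in> Obj C" and f: "alg_hom C A B f"
    and surj: "\<And>\<Gamma> b. b \<in> hom C \<Gamma> (car B) \<Longrightarrow> \<exists>a\<in>hom C \<Gamma> (car A). f \<bullet> a = b"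
    and inj: "\<And>\<Gamma> a a'. a \<in> hom C \<Gamma> (car A) \<Longrightarrow> a' \<in> hom C \<Gamma> (car A) \<Longrightarrow> f \<bullet> a = f \<bullet> a' \<Longrightarrow> a = a'"
  shows "alg_iso C A B f"
proof -
  note [simp] = A B str[unfolded hom_iff] bdl_hom_type[OF alg_hom_bdl[OF f]] alg_hom_str[OF f]
    bdl_hom_at[OF alg_hom_bdl[OF f] A]
  obtain g where g: "g \<in> hom C (car B) (car A)" and fg: "f \<bullet> g = ident C (car B)"
    using surj[of "ident C (car B)" "car B"] by auto
  note [simp] = g[unfolded hom_iff]
  have fg': "f \<bullet> g \<bullet> a = a" if "a \<in> Arr C" "Cod C a = car B" for a
    using that fg by (simp flip: comp_assoc')
  have gf: "g \<bullet> f = ident C (car A)"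
    by (rule inj[of _ "car A"]) (auto simp: fg')
  have gf': "g \<bullet> f \<bullet> a = a" if "a \<in> Arr C" "Cod C a = car A" for a
    using that gf by (simp flip: comp_assoc')
  have pull: "g \<bullet> b = a" if "b = f \<bullet> a" "a \<in> Arr C" "Cod C a = car A" for a b
    using that gf' by simp
  have "bdl_hom C B A g"
    unfolding bdl_hom_def
    by (intro conjI ballI; (rule pull)?) (auto simp: fg')
  moreover have "g \<bullet> str B = str A"
    by (rule pull) auto
  ultimately show ?thesis
    unfolding alg_iso_def alg_hom_def[of C B A] using f fg gf by blast
qed

lemma alg_isoD:
  assumes "alg_iso C A B f"
  shows "b \<in> hom C \<Gamma> (car B) \<Longrightarrow> \<exists>a\<in>hom C \<Gamma> (car A). f \<bullet> a = b"
    and "a \<in> hom C \<Gamma> (car A) \<Longrightarrow> a' \<in> hom C \<Gamma> (car A) \<Longrightarrow> f \<bullet> a = f \<bullet> a' \<Longrightarrow> a = a'"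
proof -
  obtain g where f: "alg_hom C A B f" and g: "alg_hom C B A g" and gf: "g \<bullet> f = ident C (car A)"
    and fg: "f \<bullet> g = ident C (car B)"
    using assms unfolding alg_iso_def by blast
  note [simp] = bdl_hom_type[OF alg_hom_bdl[OF f]] bdl_hom_type[OF alg_hom_bdl[OF g]]
  show "\<exists>a\<in>hom C \<Gamma> (car A). f \<bullet> a = b" if "b \<in> hom C \<Gamma> (car B)"
  proof
    have "(f \<bullet> g) \<bullet> b = b" using that unfolding fg by simp
    then show "f \<bullet> g \<bullet> b = b" using that by simp
    show "g \<bullet> b \<in> hom C \<Gamma> (car A)" using that by simp
  qed
  show "a = a'" if "a \<in> hom C \<Gamma> (car A)" "a' \<in> hom C \<Gamma> (car A)" "f \<bullet> a = f \<bullet> a'"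
  proof -
    have "g \<bullet> f \<bullet> a = g \<bullet> f \<bullet> a'" using that by simp
    moreover have "(g \<bullet> f) \<bullet> a = a" "(g \<bullet> f) \<bullet> a' = a'" using that unfolding gf by simp_all
    ultimately show ?thesis using that by simp
  qed
qed

end

section \<open>The spectrum of a polynomial algebra\<close>

context poly_coords
begin

lemmas lattices = I alg_bdl[OF A] alg_bdl[OF P]

lemma coord_types [simp]:
  "u \<in> Arr C" "Dom C u = car A" "Cod C u = car P" "j \<in> Arr C" "Dom C j = one C" "Cod C j = car P"
  "e0 \<in> Arr C" "Dom C e0 = car P" "Cod C e0 = car A" "e1 \<in> Arr C" "Dom C e1 = car P" "Cod C e1 = car A"
  using j bdl_hom_type[OF alg_hom_bdl[OF u]] bdl_hom_type[OF alg_hom_bdl[OF e0]]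
    bdl_hom_type[OF alg_hom_bdl[OF e1]] by simp_all

declare lattices [simp] str_type[OF A, simp] str_type[OF P, simp]
  bdl_hom_at[OF alg_hom_bdl[OF u] lattices(2), simp]
  bdl_hom_at[OF alg_hom_bdl[OF e0] lattices(3), simp] bdl_hom_at[OF alg_hom_bdl[OF e1] lattices(3), simp]

lemma coord_comp [simp]:
  "a \<in> Arr C \<Longrightarrow> Cod C a = car A \<Longrightarrow> e0 \<bullet> u \<bullet> a = a"
  "a \<in> Arr C \<Longrightarrow> Cod C a = car A \<Longrightarrow> e1 \<bullet> u \<bullet> a = a"
  "\<Gamma> \<in> Obj C \<Longrightarrow> e0 \<bullet> j \<bullet> bang C \<Gamma> = bot_at C A \<Gamma>"
  "\<Gamma> \<in> Obj C \<Longrightarrow> e1 \<bullet> j \<bullet> bang C \<Gamma> = top_at C A \<Gamma>"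
  "i \<in> Arr C \<Longrightarrow> Cod C i = car I \<Longrightarrow> e0 \<bullet> str P \<bullet> i = str A \<bullet> i"
  "i \<in> Arr C \<Longrightarrow> Cod C i = car I \<Longrightarrow> e1 \<bullet> str P \<bullet> i = str A \<bullet> i"
proof -
  show "e0 \<bullet> u \<bullet> a = a" "e1 \<bullet> u \<bullet> a = a" if "a \<in> Arr C" "Cod C a = car A"
    using that e0_u e1_u by (simp_all flip: comp_assoc')
  show "e0 \<bullet> j \<bullet> bang C \<Gamma> = bot_at C A \<Gamma>" "e1 \<bullet> j \<bullet> bang C \<Gamma> = top_at C A \<Gamma>" if "\<Gamma> \<in> Obj C"
    using that e0_j e1_j by (simp_all flip: comp_assoc')
  show "e0 \<bullet> str P \<bullet> i = str A \<bullet> i" "e1 \<bullet> str P \<bullet> i = str A \<bullet> i" if "i \<in> Arr C" "Cod C i = car I"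
    using that alg_hom_str[OF e0] alg_hom_str[OF e1] by (simp_all flip: comp_assoc')
qed

lemma decomp_mix:
  "p \<in> hom C \<Gamma> (car P) \<Longrightarrow> mix_at P (j \<bullet> bang C \<Gamma>) (u \<bullet> e0 \<bullet> p) (u \<bullet> e1 \<bullet> p) = p"
  unfolding mix_at_def by (rule decomp)

text \<open>The point \<open>(x, i)\<close> of \<open>Spec A \<times> I\<close> at stage \<open>\<Gamma>\<close>, as a homomorphism on \<open>A[j]\<close>.\<close>

definition spec_ext :: "'a \<Rightarrow> 'b \<Rightarrow> 'b \<Rightarrow> 'b" where
  "spec_ext \<Gamma> x i = curry_arr C \<Gamma> (car P) (mix_at I (i \<bullet> proj1 C \<Gamma> (car P))
     (app C (car A) (car I) (x \<bullet> proj1 C \<Gamma> (car P)) (e0 \<bullet> proj2 C \<Gamma> (car P)))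
     (app C (car A) (car I) (x \<bullet> proj1 C \<Gamma> (car P)) (e1 \<bullet> proj2 C \<Gamma> (car P))))"

lemma spec_ext_type [simp]:
  assumes "x \<in> Arr C" "Dom C x = \<Gamma>" "Cod C x = exp_obj C (car A) (car I)" "i \<in> Arr C" "Dom C i = \<Gamma>" "Cod C i = car I"
  shows "spec_ext \<Gamma> x i \<in> Arr C" "Dom C (spec_ext \<Gamma> x i) = \<Gamma>" "Cod C (spec_ext \<Gamma> x i) = exp_obj C (car P) (car I)"
  using assms dom_obj[of x] by (simp_all add: spec_ext_def)

lemma app_spec_ext [simp]:
  assumes "x \<in> Arr C" "Dom C x = \<Gamma>" "Cod C x = exp_obj C (car A) (car I)" "i \<in> Arr C" "Dom C i = \<Gamma>" "Cod C i = car I"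
    "s \<in> Arr C" "Cod C s = \<Gamma>" "p \<in> Arr C" "Dom C p = Dom C s" "Cod C p = car P"
  shows "app C (car P) (car I) (spec_ext \<Gamma> x i \<bullet> s) p =
    mix_at I (i \<bullet> s) (app C (car A) (car I) (x \<bullet> s) (e0 \<bullet> p)) (app C (car A) (car I) (x \<bullet> s) (e1 \<bullet> p))"
  using assms dom_obj[of x] by (simp add: spec_ext_def)

text \<open>Homomorphisms are monotone. This supplies the order condition when interpolants of
  values of \<open>x\<close> are multiplied or evaluated at the top.\<close>

lemma app_coord_le:
  assumes "hom_at C I A (base_alg C I) \<Gamma> x" "p \<in> hom C \<Gamma> (car P)"
  shows "meet_at C I (app C (car A) (car I) x (e0 \<bullet> p)) (app C (car A) (car I) x (e1 \<bullet> p)) =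
    app C (car A) (car I) x (e0 \<bullet> p)"
  using arg_cong[OF e0_le_e1[OF assms(2)], of "app C (car A) (car I) x"] assms
  by (simp add: hom_at_app)

text \<open>The counterpart of \<open>alg_hom_mix\<close> at a stage: neither \<open>x\<close> nor
  \<open>i\<close> is global, so the homomorphism laws are verified on the formula.\<close>

lemma hom_at_spec_ext:
  assumes x: "hom_at C I A (base_alg C I) \<Gamma> x" and i: "i \<in> hom C \<Gamma> (car I)"
  shows "hom_at C I P (base_alg C I) \<Gamma> (spec_ext \<Gamma> x i)"
proof (rule hom_atI)
  note [simp] = hom_at_type[OF x] i[unfolded hom_iff]
  show "spec_ext \<Gamma> x i \<in> hom C \<Gamma> (exp_obj C (car P) (car I))" by simp
  fix \<Delta> s assume \<Delta>: "\<Delta> \<in> Obj C" and s: "s \<in> hom C \<Delta> \<Gamma>"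
  note xs = hom_at_comp[OF x s]
  note [simp] = \<Delta> s[unfolded hom_iff] hom_at_app[OF xs]
  {
    fix a b assume a: "a \<in> hom C \<Delta> (car P)" and b: "b \<in> hom C \<Delta> (car P)"
    then show "app C (car P) (car I) (spec_ext \<Gamma> x i \<bullet> s) (join_at C P a b) =
        join_at C I (app C (car P) (car I) (spec_ext \<Gamma> x i \<bullet> s) a) (app C (car P) (car I) (spec_ext \<Gamma> x i \<bullet> s) b)"
      by (simp, intro mix_at(1)[OF I \<Delta>]) simp_all
    from a b show "app C (car P) (car I) (spec_ext \<Gamma> x i \<bullet> s) (meet_at C P a b) =
        meet_at C I (app C (car P) (car I) (spec_ext \<Gamma> x i \<bullet> s) a) (app C (car P) (car I) (spec_ext \<Gamma> x i \<bullet> s) b)"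
      by (simp, intro mix_at(2)[OF I \<Delta>] app_coord_le[OF xs]) simp_all
  }
  show "app C (car P) (car I) (spec_ext \<Gamma> x i \<bullet> s) (bot_at C P \<Delta>) = bot_at C I \<Delta>"
    "app C (car P) (car I) (spec_ext \<Gamma> x i \<bullet> s) (top_at C P \<Delta>) = top_at C I \<Delta>"
    by (simp, rule mix_at(3)[OF I \<Delta>]; simp)+
  show "app C (car P) (car I) (spec_ext \<Gamma> x i \<bullet> s) (str P \<bullet> k) = k" if "k \<in> hom C \<Delta> (car I)" for k
    using that by (simp, intro mix_at(3)[OF I \<Delta>]) simp_all
qed

text \<open>The components \<open>i\<close> and \<open>x\<close> are recovered as the value at
  \<open>j\<close> and the restriction along \<open>u\<close>.\<close>

lemma spec_ext_generators:
  assumes x: "hom_at C I A (base_alg C I) \<Gamma> x" and i: "i \<in> hom C \<Gamma> (car I)" and s: "s \<in> hom C \<Delta> \<Gamma>"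
  shows "app C (car P) (car I) (spec_ext \<Gamma> x i \<bullet> s) (j \<bullet> bang C \<Delta>) = i \<bullet> s"
    "a \<in> hom C \<Delta> (car A) \<Longrightarrow> app C (car P) (car I) (spec_ext \<Gamma> x i \<bullet> s) (u \<bullet> a) = app C (car A) (car I) (x \<bullet> s) a"
proof -
  have \<Delta>: "\<Delta> \<in> Obj C" using s by auto
  note [simp] = hom_at_type[OF x] i[unfolded hom_iff] s[unfolded hom_iff] hom_at_app[OF hom_at_comp[OF x s]]
  note [simp] = \<Delta>
  show "app C (car P) (car I) (spec_ext \<Gamma> x i \<bullet> s) (j \<bullet> bang C \<Delta>) = i \<bullet> s"
    by (simp, intro mix_at(6)[OF I \<Delta>]) simp
  show "app C (car P) (car I) (spec_ext \<Gamma> x i \<bullet> s) (u \<bullet> a) = app C (car A) (car I) (x \<bullet> s) a"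
    if "a \<in> hom C \<Delta> (car A)"
    using that by (simp, intro mix_at(3)[OF I \<Delta>]) simp_all
qed

text \<open>The extension at the generic point of \<open>Spec A \<times> I\<close>; all other points
  arise from it by reindexing.\<close>

definition poly_spec_incl :: "'a \<Rightarrow> 'b \<Rightarrow> 'b" where
  "poly_spec_incl S m =
    spec_ext (prod_obj C S (car I)) (m \<bullet> proj1 C S (car I)) (proj2 C S (car I))"

context
  fixes S :: 'a and m :: 'b
  assumes Spec: "is_Spec C I A S m"
begin

lemmas Spec_types [simp] = is_SpecD(1-4)[OF Spec]

lemma hom_at_m_proj1: "hom_at C I A (base_alg C I) (prod_obj C S (car I)) (m \<bullet> proj1 C S (car I))"
  by (rule is_SpecD(5)[OF Spec]) simp

lemma poly_spec_incl_type [simp]: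
  "poly_spec_incl S m \<in> Arr C" "Dom C (poly_spec_incl S m) = prod_obj C S (car I)"
  "Cod C (poly_spec_incl S m) = exp_obj C (car P) (car I)"
  by (simp_all add: poly_spec_incl_def)

lemma app_poly_spec_incl:
  assumes "y \<in> hom C \<Gamma> (prod_obj C S (car I))" "p \<in> hom C \<Gamma> (car P)"
  shows "app C (car P) (car I) (poly_spec_incl S m \<bullet> y) p =
    mix_at I (proj2 C S (car I) \<bullet> y) (app C (car A) (car I) (m \<bullet> proj1 C S (car I) \<bullet> y) (e0 \<bullet> p))
      (app C (car A) (car I) (m \<bullet> proj1 C S (car I) \<bullet> y) (e1 \<bullet> p))"
  using assms by (simp add: poly_spec_incl_def)

lemma poly_spec_incl_generators:
  assumes "y \<in> hom C \<Gamma> (prod_obj C S (car I))"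
  shows "app C (car P) (car I) (poly_spec_incl S m \<bullet> y) (j \<bullet> bang C \<Gamma>) = proj2 C S (car I) \<bullet> y"
    "a \<in> hom C \<Gamma> (car A) \<Longrightarrow> app C (car P) (car I) (poly_spec_incl S m \<bullet> y) (u \<bullet> a) =
      app C (car A) (car I) (m \<bullet> proj1 C S (car I) \<bullet> y) a"
  using spec_ext_generators[OF hom_at_m_proj1 _ assms, of "proj2 C S (car I)"] assms
  by (simp_all add: poly_spec_incl_def)

text \<open>Injectivity holds because the generators recover both components of a point. Conversely,
  applying a homomorphism to the normal form of \<open>p\<close> shows that it is the interpolation
  determined by its restriction along \<open>u\<close> and its value at \<open>j\<close>.\<close>

lemma is_Spec_poly: "is_Spec C I P (prod_obj C S (car I)) (poly_spec_incl S m)"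
proof (rule is_SpecI)
  show "prod_obj C S (car I) \<in> Obj C" by simp
  show "poly_spec_incl S m \<in> hom C (prod_obj C S (car I)) (exp_obj C (car P) (car I))" by simp
next
  fix \<Gamma> y assume y: "y \<in> hom C \<Gamma> (prod_obj C S (car I))"
  show "hom_at C I P (base_alg C I) \<Gamma> (poly_spec_incl S m \<bullet> y)"
    unfolding poly_spec_incl_def
    by (rule hom_at_comp[OF hom_at_spec_ext[OF hom_at_m_proj1] y]) simp
next
  fix \<Gamma> y y' assume y: "y \<in> hom C \<Gamma> (prod_obj C S (car I))" and y': "y' \<in> hom C \<Gamma> (prod_obj C S (car I))"
    and eq: "poly_spec_incl S m \<bullet> y = poly_spec_incl S m \<bullet> y'"
  note [simp] = y[unfolded hom_iff] y'[unfolded hom_iff]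
  have 2: "proj2 C S (car I) \<bullet> y = proj2 C S (car I) \<bullet> y'"
    using poly_spec_incl_generators(1)[OF y] poly_spec_incl_generators(1)[OF y'] eq by simp
  have my: "m \<bullet> proj1 C S (car I) \<bullet> y = m \<bullet> proj1 C S (car I) \<bullet> y'"
  proof (rule exp_ext[of "car A" "car I" _ _ \<Gamma>])
    fix \<Delta> s a assume *: "\<Delta> \<in> Obj C" "s \<in> Arr C" "Dom C s = \<Delta>" "Cod C s = \<Gamma>" "a \<in> Arr C" "Dom C a = \<Delta>" "Cod C a = car A"
    have "poly_spec_incl S m \<bullet> y \<bullet> s = poly_spec_incl S m \<bullet> y' \<bullet> s"
      using arg_cong[OF eq, of "\<lambda>f. f \<bullet> s"] * by simp
    with * show "app C (car A) (car I) ((m \<bullet> proj1 C S (car I) \<bullet> y) \<bullet> s) a =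
      app C (car A) (car I) ((m \<bullet> proj1 C S (car I) \<bullet> y') \<bullet> s) a"
      using poly_spec_incl_generators(2)[of "y \<bullet> s" \<Delta> a] poly_spec_incl_generators(2)[of "y' \<bullet> s" \<Delta> a] by simp
  qed simp_all
  have 1: "proj1 C S (car I) \<bullet> y = proj1 C S (car I) \<bullet> y'"
    by (rule is_SpecD(6)[OF Spec _ _ my, of \<Gamma>]) simp_all
  show "y = y'" by (rule prod_ext[OF _ _ _ _ _ _ 1 2]) simp_all
next
  fix \<Gamma> z assume z: "hom_at C I P (base_alg C I) \<Gamma> z"
  have \<Gamma> [simp]: "\<Gamma> \<in> Obj C" using hom_at_type[OF z] by auto
  note [simp] = hom_at_type[OF z]
  \<comment> \<open>The restriction of \<open>z\<close> along \<open>u\<close>, the first component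
    of the point sought.\<close>
  define x where "x = curry_arr C \<Gamma> (car A)
    (app C (car P) (car I) (z \<bullet> proj1 C \<Gamma> (car A)) (u \<bullet> proj2 C \<Gamma> (car A)))"
  have x_type [simp]: "x \<in> Arr C" "Dom C x = \<Gamma>" "Cod C x = exp_obj C (car A) (car I)"
    by (simp_all add: x_def)
  have x_app: "app C (car A) (car I) (x \<bullet> s) a = app C (car P) (car I) (z \<bullet> s) (u \<bullet> a)"
    if "s \<in> hom C \<Delta> \<Gamma>" "a \<in> hom C \<Delta> (car A)" for \<Delta> s a
    using that by (simp add: x_def)
  have u_str: "u \<bullet> str A \<bullet> i = str P \<bullet> i" if "i \<in> hom C \<Delta> (car I)" for \<Delta> i
    using that alg_hom_str[OF u] by (simp flip: comp_assoc')
  have "hom_at C I A (base_alg C I) \<Gamma> x"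
  proof (rule hom_atI)
    show "x \<in> hom C \<Gamma> (exp_obj C (car A) (car I))" by simp
    fix \<Delta> s assume \<Delta>: "\<Delta> \<in> Obj C" and s: "s \<in> hom C \<Delta> \<Gamma>"
    note [simp] = hom_at_app[OF hom_at_comp[OF z s]] x_app[OF s] u_str[of _ \<Delta>] \<Delta>
    {
      fix a b assume a: "a \<in> hom C \<Delta> (car A)" and b: "b \<in> hom C \<Delta> (car A)"
      then show "app C (car A) (car I) (x \<bullet> s) (join_at C A a b) =
          join_at C I (app C (car A) (car I) (x \<bullet> s) a) (app C (car A) (car I) (x \<bullet> s) b)"
        "app C (car A) (car I) (x \<bullet> s) (meet_at C A a b) =
          meet_at C I (app C (car A) (car I) (x \<bullet> s) a) (app C (car A) (car I) (x \<bullet> s) b)"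
        by simp_all
    }
    show "app C (car A) (car I) (x \<bullet> s) (bot_at C A \<Delta>) = bot_at C I \<Delta>"
      "app C (car A) (car I) (x \<bullet> s) (top_at C A \<Delta>) = top_at C I \<Delta>"
      by simp_all
    show "app C (car A) (car I) (x \<bullet> s) (str A \<bullet> k) = k" if "k \<in> hom C \<Delta> (car I)" for k
      using that by simp
  qed
  then obtain y where y: "y \<in> hom C \<Gamma> S" and my: "m \<bullet> y = x"
    using is_SpecD(7)[OF Spec] by blast
  \<comment> \<open>The value of \<open>z\<close> at the generator, the second component.\<close>
  define i where "i = app C (car P) (car I) z (j \<bullet> bang C \<Gamma>)"
  have i [simp]: "i \<in> Arr C" "Dom C i = \<Gamma>" "Cod C i = car I"
    by (simp_all add: i_def)
  note [simp] = y[unfolded hom_iff]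
  have my': "m \<bullet> y \<bullet> s = x \<bullet> s" if "s \<in> hom C \<Delta> \<Gamma>" for s \<Delta>
    using arg_cong[OF my, of "\<lambda>f. f \<bullet> s"] that by simp
  have "poly_spec_incl S m \<bullet> tuple C y i = z"
  proof (rule exp_ext[of "car P" "car I" _ _ \<Gamma>])
    fix \<Delta> s p assume *: "\<Delta> \<in> Obj C" "s \<in> Arr C" "Dom C s = \<Delta>" "Cod C s = \<Gamma>" "p \<in> Arr C" "Dom C p = \<Delta>" "Cod C p = car P"
    then have s: "s \<in> hom C \<Delta> \<Gamma>" and p: "p \<in> hom C \<Delta> (car P)" by simp_all
    note zs = hom_at_comp[OF z s]
    have "app C (car P) (car I) (z \<bullet> s) p =
      app C (car P) (car I) (z \<bullet> s) (mix_at P (j \<bullet> bang C \<Delta>) (u \<bullet> e0 \<bullet> p) (u \<bullet> e1 \<bullet> p))"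
      by (simp only: decomp_mix[OF p])
    also have "\<dots> = mix_at I (i \<bullet> s) (app C (car A) (car I) (x \<bullet> s) (e0 \<bullet> p)) (app C (car A) (car I) (x \<bullet> s) (e1 \<bullet> p))"
      using * by (simp add: hom_at_mix[OF zs] x_app[OF s] i_def)
    also have "\<dots> = app C (car P) (car I) ((poly_spec_incl S m \<bullet> tuple C y i) \<bullet> s) p"
      using * app_poly_spec_incl[of "tuple C (y \<bullet> s) (i \<bullet> s)" \<Delta> p] my'[OF s] by simp
    finally show "app C (car P) (car I) ((poly_spec_incl S m \<bullet> tuple C y i) \<bullet> s) p = app C (car P) (car I) (z \<bullet> s) p"
      by simp
  qed simp_all
  then show "\<exists>y\<in>hom C \<Gamma> (prod_obj C S (car I)). poly_spec_incl S m \<bullet> y = z"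
    by (intro bexI[of _ "tuple C y i"]) simp_all
qed

end

text \<open>A function \<open>\<alpha> : I \<rightarrow> A\<close> induces a function on the
  spectrum of \<open>P\<close>; surjectivity represents it by a polynomial \<open>p\<close>, and
  interpolants satisfy the Phoa equation. The spectrum \<open>S'\<close> is an arbitrary one, not a
  product, so a point is split into components by its action on \<open>j\<close> and along
  \<open>u\<close>.\<close>

lemma phoa_of_quasi_coherent_poly:
  assumes Spec: "is_Spec C I A S m"
    and inj: "\<And>\<Gamma> a a'. a \<in> hom C \<Gamma> (car A) \<Longrightarrow> a' \<in> hom C \<Gamma> (car A) \<Longrightarrow>
      iota C I A S m \<bullet> a = iota C I A S m \<bullet> a' \<Longrightarrow> a = a'"
    and Spec': "is_Spec C I P S' m'"
    and surj: "\<And>\<Gamma> F. F \<in> hom C \<Gamma> (exp_obj C S' (car I)) \<Longrightarrow>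
      \<exists>p\<in>hom C \<Gamma> (car P). iota C I P S' m' \<bullet> p = F"
  shows "gen_phoa C I A"
  unfolding gen_phoa_def Let_def
proof (intro ballI)
  fix \<Gamma> \<alpha> k assume \<Gamma>: "\<Gamma> \<in> Obj C" and \<alpha>: "\<alpha> \<in> hom C \<Gamma> (exp_obj C (car I) (car A))" and k: "k \<in> hom C \<Gamma> (car I)"
  note [simp] = is_SpecD(1-4)[OF Spec] is_SpecD(1-4)[OF Spec'] \<Gamma> \<alpha>[unfolded hom_iff] k[unfolded hom_iff]
    iota_type[OF lattices(1,2) Spec, unfolded hom_iff] iota_type[OF lattices(1,3) Spec', unfolded hom_iff]
  let ?y = "m' \<bullet> proj2 C \<Gamma> S'"
  \<comment> \<open>\<open>F y = y (u (\<alpha> (y j)))\<close>, which at \<open>y = (x, i)\<close> is \<open>x (\<alpha> i)\<close>\<close>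
  define F where "F = curry_arr C \<Gamma> S' (app C (car P) (car I) ?y (u \<bullet> app C (car I) (car A) (\<alpha> \<bullet> proj1 C \<Gamma> S')
    (app C (car P) (car I) ?y (j \<bullet> bang C (prod_obj C \<Gamma> S')))))"
  have F_app: "app C S' (car I) (F \<bullet> s) y = app C (car P) (car I) (m' \<bullet> y) (u \<bullet> app C (car I) (car A) (\<alpha> \<bullet> s)
     (app C (car P) (car I) (m' \<bullet> y) (j \<bullet> bang C \<Delta>)))"
    if "s \<in> hom C \<Delta> \<Gamma>" "y \<in> hom C \<Delta> S'" for \<Delta> s y
    using that by (simp add: F_def)
  have "F \<in> hom C \<Gamma> (exp_obj C S' (car I))" by (simp add: F_def)
  from surj[OF this] obtain p where p: "p \<in> hom C \<Gamma> (car P)" and Fp: "iota C I P S' m' \<bullet> p = F"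
    by blast
  note [simp] = p[unfolded hom_iff]
  \<comment> \<open>Injectivity of \<open>iota\<close> for \<open>A\<close> reduces this to points
    \<open>x\<close> of \<open>Spec A\<close>, where both sides are the value of \<open>F\<close> at
    \<open>(x, i)\<close>.\<close>
  have key: "mix_at A (str A \<bullet> i) (e0 \<bullet> p) (e1 \<bullet> p) = app C (car I) (car A) \<alpha> i"
    if i: "i \<in> hom C \<Gamma> (car I)" for i
  proof (rule inj[of _ \<Gamma>])
    note [simp] = i[unfolded hom_iff]
    show "mix_at A (str A \<bullet> i) (e0 \<bullet> p) (e1 \<bullet> p) \<in> hom C \<Gamma> (car A)" "app C (car I) (car A) \<alpha> i \<in> hom C \<Gamma> (car A)"
      by simp_all
    show "iota C I A S m \<bullet> mix_at A (str A \<bullet> i) (e0 \<bullet> p) (e1 \<bullet> p) = iota C I A S m \<bullet> app C (car I) (car A) \<alpha> i"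
    proof (rule exp_ext[of S "car I" _ _ \<Gamma>])
      fix \<Delta> s x assume *: "\<Delta> \<in> Obj C" "s \<in> Arr C" "Dom C s = \<Delta>" "Cod C s = \<Gamma>" "x \<in> Arr C" "Dom C x = \<Delta>" "Cod C x = S"
      then have s: "s \<in> hom C \<Delta> \<Gamma>" and x: "x \<in> hom C \<Delta> S" by simp_all
      note mx = is_SpecD(5)[OF Spec x]
      have i_s: "i \<bullet> s \<in> hom C \<Delta> (car I)" and id: "ident C \<Delta> \<in> hom C \<Delta> \<Delta>" using * by simp_all
      \<comment> \<open>\<open>S'\<close> represents all homomorphisms on \<open>P\<close>, hence
        contains the point \<open>(x, i)\<close>.\<close>
      obtain y where y: "y \<in> hom C \<Delta> S'" and my: "m' \<bullet> y = spec_ext \<Delta> (m \<bullet> x) (i \<bullet> s)"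
        using is_SpecD(7)[OF Spec' hom_at_spec_ext[OF mx i_s]] by blast
      have z: "spec_ext \<Delta> (m \<bullet> x) (i \<bullet> s) \<bullet> ident C \<Delta> = spec_ext \<Delta> (m \<bullet> x) (i \<bullet> s)"
        using * by simp
      have "app C S' (car I) (F \<bullet> s) y = app C (car A) (car I) (m \<bullet> x) (app C (car I) (car A) (\<alpha> \<bullet> s) (i \<bullet> s))"
        using * spec_ext_generators[OF mx i_s id, unfolded z] by (simp add: F_app[OF s y] my)
      \<comment> \<open>The same value computed from the representing polynomial: the point
        \<open>(x, i)\<close> interpolates between the coordinates of \<open>p\<close>.\<close>
      moreover have "app C S' (car I) (F \<bullet> s) y = mix_at I (i \<bullet> s)
          (app C (car A) (car I) (m \<bullet> x) (e0 \<bullet> p \<bullet> s)) (app C (car A) (car I) (m \<bullet> x) (e1 \<bullet> p \<bullet> s))"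
        using * y app_iota[OF lattices(1,3) Spec', of "p \<bullet> s" y]
          app_spec_ext[of "m \<bullet> x" \<Delta> "i \<bullet> s" "ident C \<Delta>" "p \<bullet> s", unfolded z]
        by (simp add: my flip: Fp)
      ultimately show "app C S (car I) ((iota C I A S m \<bullet> mix_at A (str A \<bullet> i) (e0 \<bullet> p) (e1 \<bullet> p)) \<bullet> s) x =
          app C S (car I) ((iota C I A S m \<bullet> app C (car I) (car A) \<alpha> i) \<bullet> s) x"
        using * by (simp add: app_iota[OF lattices(1,2) Spec] hom_at_mix[OF mx] hom_at_app[OF mx])
    qed simp_all
  qed
  have str_hom: "bdl_hom C I A (str A)" using A by (simp add: internal_alg_def)
  note mix = mix_at[OF lattices(2) \<Gamma>]
  \<comment> \<open>Taking \<open>i\<close> to be 0 and 1 identifies the end values of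
    \<open>\<alpha>\<close>. At 1 a join appears, which collapses because the coordinates are
    ordered.\<close>
  have "app C (car I) (car A) \<alpha> (bot_at C I \<Gamma>) = e0 \<bullet> p"
    using key[of "bot_at C I \<Gamma>"] mix(4)[of "e0 \<bullet> p" "e1 \<bullet> p"] by (simp add: bdl_hom_at[OF str_hom I])
  moreover have "app C (car I) (car A) \<alpha> (top_at C I \<Gamma>) = join_at C A (e0 \<bullet> p) (e1 \<bullet> p)"
    using key[of "top_at C I \<Gamma>"] mix(5)[of "e0 \<bullet> p" "e1 \<bullet> p"] by (simp add: bdl_hom_at[OF str_hom I])
  moreover have "join_at C A (e0 \<bullet> p) (e1 \<bullet> p) = e1 \<bullet> p"
    by (rule le_join_at[OF lattices(2) \<Gamma>]) (simp_all add: e0_le_e1[OF p])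
  ultimately show "app C (car I) (car A) \<alpha> k = join_at C A (app C (car I) (car A) \<alpha> (bot_at C I \<Gamma>))
      (meet_at C A (str A \<bullet> k) (app C (car I) (car A) \<alpha> (top_at C I \<Gamma>)))"
    using key[OF k] by (simp add: mix_at_def)
qed

text \<open>The product spectrum is used here. A function on \<open>Spec A \<times> I\<close> at
  stage \<open>\<Gamma>\<close> is a function on \<open>Spec A\<close> at stage
  \<open>\<Gamma> \<times> I\<close>, so quasi-coherence of \<open>A\<close> is needed at stages
  other than \<open>\<Gamma>\<close>; this is why \<open>inj\<close> and \<open>surj\<close> range
  over all of them.\<close>

lemma quasi_coherent_poly_of_phoa:
  assumes Spec: "is_Spec C I A S m"
    and inj: "\<And>\<Gamma> a a'. a \<in> hom C \<Gamma> (car A) \<Longrightarrow> a' \<in> hom C \<Gamma> (car A) \<Longrightarrow>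
      iota C I A S m \<bullet> a = iota C I A S m \<bullet> a' \<Longrightarrow> a = a'"
    and surj: "\<And>\<Gamma> F. F \<in> hom C \<Gamma> (exp_obj C S (car I)) \<Longrightarrow>
      \<exists>a\<in>hom C \<Gamma> (car A). iota C I A S m \<bullet> a = F"
    and phoa: "gen_phoa C I A"
  shows "quasi_coherent C I P"
proof -
  let ?S = "prod_obj C S (car I)" and ?m = "poly_spec_incl S m"
  note Spec' = is_Spec_poly[OF Spec]
  note [simp] = is_SpecD(1-4)[OF Spec] poly_spec_incl_type[OF Spec]
    iota_type[OF lattices(1,2) Spec, unfolded hom_iff] iota_type[OF lattices(1,3) Spec', unfolded hom_iff]
    app_iota[OF lattices(1,2) Spec] app_iota[OF lattices(1,3) Spec']
  have phoa': "app C (car I) (car A) \<alpha> i = mix_at A (str A \<bullet> i)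
      (app C (car I) (car A) \<alpha> (bot_at C I \<Gamma>)) (app C (car I) (car A) \<alpha> (top_at C I \<Gamma>))"
    if "\<alpha> \<in> hom C \<Gamma> (exp_obj C (car I) (car A))" "i \<in> hom C \<Gamma> (car I)" for \<Gamma> \<alpha> i
  proof -
    have "\<Gamma> \<in> Obj C" using that by auto
    with that phoa show ?thesis unfolding gen_phoa_def Let_def mix_at_def by blast
  qed
  have "alg_iso C P (fun_alg C I ?S) (iota C I P ?S ?m)"
  proof (rule alg_isoI)
    show "internal_bdl C P" by simp
    show "str P \<in> hom C (car I) (car P)" by simp
    show "car (fun_alg C I ?S) \<in> Obj C" by (simp add: fun_alg_sel)
    show "alg_hom C P (fun_alg C I ?S) (iota C I P ?S ?m)" by (rule iota_hom[OF I P Spec'])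
  next
    fix \<Gamma> p p' assume p: "p \<in> hom C \<Gamma> (car P)" and p': "p' \<in> hom C \<Gamma> (car P)"
      and eq: "iota C I P ?S ?m \<bullet> p = iota C I P ?S ?m \<bullet> p'"
    note [simp] = p[unfolded hom_iff] p'[unfolded hom_iff]
    have key: "mix_at I i (app C (car A) (car I) (m \<bullet> x) (e0 \<bullet> p \<bullet> s)) (app C (car A) (car I) (m \<bullet> x) (e1 \<bullet> p \<bullet> s)) =
      mix_at I i (app C (car A) (car I) (m \<bullet> x) (e0 \<bullet> p' \<bullet> s)) (app C (car A) (car I) (m \<bullet> x) (e1 \<bullet> p' \<bullet> s))"
      if "s \<in> hom C \<Delta> \<Gamma>" "x \<in> hom C \<Delta> S" "i \<in> hom C \<Delta> (car I)" for \<Delta> s x i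
    proof -
      have "(iota C I P ?S ?m \<bullet> p) \<bullet> s = (iota C I P ?S ?m \<bullet> p') \<bullet> s" unfolding eq ..
      then have "app C ?S (car I) (iota C I P ?S ?m \<bullet> p \<bullet> s) (tuple C x i)
          = app C ?S (car I) (iota C I P ?S ?m \<bullet> p' \<bullet> s) (tuple C x i)"
        using that by simp
      then show ?thesis
        using that app_poly_spec_incl[OF Spec, of "tuple C x i" \<Delta>] by simp
    qed
    \<comment> \<open>Setting \<open>i\<close> to 0 isolates the lower coordinates; at 1 the value
      is a join, which equals the upper one by monotonicity of points.\<close>
    have ends: "e0 \<bullet> p = e0 \<bullet> p' \<and> e1 \<bullet> p = e1 \<bullet> p'"
    proof (intro conjI; rule inj[of _ \<Gamma>])
      show "iota C I A S m \<bullet> e0 \<bullet> p = iota C I A S m \<bullet> e0 \<bullet> p'"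
      proof (rule exp_ext[of S "car I" _ _ \<Gamma>])
        fix \<Delta> s x assume *: "\<Delta> \<in> Obj C" "s \<in> Arr C" "Dom C s = \<Delta>" "Cod C s = \<Gamma>" "x \<in> Arr C" "Dom C x = \<Delta>" "Cod C x = S"
        show "app C S (car I) ((iota C I A S m \<bullet> e0 \<bullet> p) \<bullet> s) x = app C S (car I) ((iota C I A S m \<bullet> e0 \<bullet> p') \<bullet> s) x"
          using key[of s \<Delta> x "bot_at C I \<Delta>"] * by (simp add: mix_at(4)[OF I, of \<Delta>])
      qed simp_all
      show "iota C I A S m \<bullet> e1 \<bullet> p = iota C I A S m \<bullet> e1 \<bullet> p'"
      proof (rule exp_ext[of S "car I" _ _ \<Gamma>])
        fix \<Delta> s x assume *: "\<Delta> \<in> Obj C" "s \<in> Arr C" "Dom C s = \<Delta>" "Cod C s = \<Gamma>" "x \<in> Arr C" "Dom C x = \<Delta>" "Cod C x = S"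
        have le: "join_at C I (app C (car A) (car I) (m \<bullet> x) (e0 \<bullet> q \<bullet> s)) (app C (car A) (car I) (m \<bullet> x) (e1 \<bullet> q \<bullet> s))
            = app C (car A) (car I) (m \<bullet> x) (e1 \<bullet> q \<bullet> s)" if "q \<in> {p, p'}" for q
          using that * by (intro le_join_at[OF I, of \<Delta>] app_coord_le is_SpecD(5)[OF Spec]) auto
        show "app C S (car I) ((iota C I A S m \<bullet> e1 \<bullet> p) \<bullet> s) x = app C S (car I) ((iota C I A S m \<bullet> e1 \<bullet> p') \<bullet> s) x"
          using key[of s \<Delta> x "top_at C I \<Delta>"] * by (simp add: mix_at(5)[OF I, of \<Delta>] le)
      qed simp_all
    qed simp_all
    show "p = p'"
      using decomp_mix[OF p] decomp_mix[OF p'] ends by metis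
  next
    fix \<Gamma> F assume "F \<in> hom C \<Gamma> (car (fun_alg C I ?S))"
    then have F: "F \<in> Arr C" "Dom C F = \<Gamma>" "Cod C F = exp_obj C ?S (car I)" by (simp_all add: fun_alg_sel)
    then have \<Gamma>: "\<Gamma> \<in> Obj C" by auto
    note [simp] = F \<Gamma>
    let ?G = "prod_obj C \<Gamma> (car I)"
    let ?\<pi> = "proj1 C ?G S"
    \<comment> \<open>\<open>F\<close> at the generic \<open>i\<close>, as a function on \<open>Spec A\<close>\<close>
    define G where "G = curry_arr C ?G S (app C ?S (car I) (F \<bullet> proj1 C \<Gamma> (car I) \<bullet> ?\<pi>)
      (tuple C (proj2 C ?G S) (proj2 C \<Gamma> (car I) \<bullet> ?\<pi>)))"
    have "G \<in> hom C ?G (exp_obj C S (car I))" by (simp add: G_def)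
    \<comment> \<open>Quasi-coherence of \<open>A\<close> at stage
      \<open>\<Gamma> \<times> I\<close> turns the family \<open>G\<close> into an element of
      \<open>A\<close> depending on a generic \<open>i\<close>; currying it gives
      \<open>\<alpha>\<close>.\<close>
    from surj[OF this] obtain a where a: "a \<in> hom C ?G (car A)" and aG: "iota C I A S m \<bullet> a = G" by blast
    note [simp] = a[unfolded hom_iff]
    define \<alpha> where "\<alpha> = curry_arr C \<Gamma> (car I) a"
    have \<alpha> [simp]: "\<alpha> \<in> Arr C" "Dom C \<alpha> = \<Gamma>" "Cod C \<alpha> = exp_obj C (car I) (car A)"
      by (simp_all add: \<alpha>_def)
    have app_a: "app C (car A) (car I) (m \<bullet> x) (app C (car I) (car A) (\<alpha> \<bullet> s) i) = app C ?S (car I) (F \<bullet> s) (tuple C x i)"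
      if "s \<in> hom C \<Delta> \<Gamma>" "x \<in> hom C \<Delta> S" "i \<in> hom C \<Delta> (car I)" for \<Delta> s x i
    proof -
      have "app C S (car I) ((iota C I A S m \<bullet> a) \<bullet> tuple C s i) x = app C S (car I) (G \<bullet> tuple C s i) x"
        unfolding aG ..
      then show ?thesis using that by (simp add: G_def \<alpha>_def)
    qed
    let ?a0 = "app C (car I) (car A) \<alpha> (bot_at C I \<Gamma>)" and ?a1 = "app C (car I) (car A) \<alpha> (top_at C I \<Gamma>)"
    \<comment> \<open>The only candidate: the polynomial whose end points are those of
      \<open>\<alpha>\<close>.\<close>
    define p where "p = mix_at P (j \<bullet> bang C \<Gamma>) (u \<bullet> ?a0) (u \<bullet> ?a1)"
    have p: "p \<in> hom C \<Gamma> (car P)" by (simp add: p_def)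
    have "iota C I P ?S ?m \<bullet> p = F"
    proof (rule exp_ext[of ?S "car I" _ _ \<Gamma>])
      fix \<Delta> s y assume *: "\<Delta> \<in> Obj C" "s \<in> Arr C" "Dom C s = \<Delta>" "Cod C s = \<Gamma>" "y \<in> Arr C" "Dom C y = \<Delta>" "Cod C y = ?S"
      then have y: "y \<in> hom C \<Delta> ?S" by simp
      let ?x = "proj1 C S (car I) \<bullet> y" and ?i = "proj2 C S (car I) \<bullet> y"
      have x: "?x \<in> hom C \<Delta> S" and i: "?i \<in> hom C \<Delta> (car I)" and s: "s \<in> hom C \<Delta> \<Gamma>"
        and \<alpha>s: "\<alpha> \<bullet> s \<in> hom C \<Delta> (exp_obj C (car I) (car A))" using * by simp_all
      note mx = is_SpecD(5)[OF Spec x] and my = is_SpecD(5)[OF Spec' y]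
      have "app C ?S (car I) ((iota C I P ?S ?m \<bullet> p) \<bullet> s) y = mix_at I ?i
         (app C (car A) (car I) (m \<bullet> ?x) (app C (car I) (car A) (\<alpha> \<bullet> s) (bot_at C I \<Delta>)))
         (app C (car A) (car I) (m \<bullet> ?x) (app C (car I) (car A) (\<alpha> \<bullet> s) (top_at C I \<Delta>)))"
        using * by (simp add: p_def hom_at_mix[OF my] poly_spec_incl_generators[OF Spec y])
      \<comment> \<open>The Phoa principle enters here: the interpolant of the end values of
        \<open>\<alpha>\<close> is \<open>\<alpha>\<close> itself. It is applied at stage
        \<open>\<Delta>\<close>, where the component \<open>?i\<close> of \<open>y\<close>
        lives.\<close>
      also have "\<dots> = app C (car A) (car I) (m \<bullet> ?x) (app C (car I) (car A) (\<alpha> \<bullet> s) ?i)"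
        unfolding phoa'[OF \<alpha>s i] using * by (simp add: hom_at_mix[OF mx] hom_at_app[OF mx])
      also have "\<dots> = app C ?S (car I) (F \<bullet> s) (tuple C ?x ?i)" by (rule app_a[OF s x i])
      also have "tuple C ?x ?i = y" by (rule tuple_eta) (use * in simp_all)
      finally show "app C ?S (car I) ((iota C I P ?S ?m \<bullet> p) \<bullet> s) y = app C ?S (car I) (F \<bullet> s) y" .
    qed (use p in simp_all)
    with p show "\<exists>p\<in>hom C \<Gamma> (car P). iota C I P ?S ?m \<bullet> p = F" by blast
  qed
  with Spec' show ?thesis unfolding quasi_coherent_def by blast
qed

end

theorem theorem7p3:
  fixes C :: "('o, 'm) ccat"
    and I :: "('o, 'm) bdl"
    and A Aj :: "('o, 'm) alg"
    and u j :: 'm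
  assumes "fin_complete_ccc C"
    and "internal_bdl C I"
    and "internal_alg C I A"
    and "quasi_coherent C I A"
    and "poly_alg C I A Aj u j"
  shows "quasi_coherent C I Aj \<longleftrightarrow> gen_phoa C I A"
proof -
  obtain e0 e1 where "poly_coords C I A Aj u j e0 e1"
    using fin_complete_ccc.poly_coords_exist[OF assms(1-3,5)] by blast
  then interpret poly_coords C I A Aj u j e0 e1 .
  obtain S m where Spec: "is_Spec C I A S m" and iso: "alg_iso C A (fun_alg C I S) (iota C I A S m)"
    using assms(4) unfolding quasi_coherent_def by blast
  show ?thesis
  proof
    assume "quasi_coherent C I Aj"
    then obtain S' m' where Spec': "is_Spec C I Aj S' m'"
      and iso': "alg_iso C Aj (fun_alg C I S') (iota C I Aj S' m')"
      unfolding quasi_coherent_def by blast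
    show "gen_phoa C I A"
    proof (rule phoa_of_quasi_coherent_poly[OF Spec _ Spec'])
      show "a = a'" if "a \<in> hom C \<Gamma> (car A)" "a' \<in> hom C \<Gamma> (car A)"
        "iota C I A S m \<bullet>\<^bsub>C\<^esub> a = iota C I A S m \<bullet>\<^bsub>C\<^esub> a'" for \<Gamma> a a'
        using that by (rule alg_isoD(2)[OF iso])
      show "\<exists>p\<in>hom C \<Gamma> (car Aj). iota C I Aj S' m' \<bullet>\<^bsub>C\<^esub> p = F"
        if "F \<in> hom C \<Gamma> (exp_obj C S' (car I))" for \<Gamma> F
        using that by (intro alg_isoD(1)[OF iso']) (simp add: fun_alg_sel)
    qed
  next
    assume phoa: "gen_phoa C I A"
    show "quasi_coherent C I Aj"
    proof (rule quasi_coherent_poly_of_phoa[OF Spec _ _ phoa])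
      show "a = a'" if "a \<in> hom C \<Gamma> (car A)" "a' \<in> hom C \<Gamma> (car A)"
        "iota C I A S m \<bullet>\<^bsub>C\<^esub> a = iota C I A S m \<bullet>\<^bsub>C\<^esub> a'" for \<Gamma> a a'
        using that by (rule alg_isoD(2)[OF iso])
      show "\<exists>a\<in>hom C \<Gamma> (car A). iota C I A S m \<bullet>\<^bsub>C\<^esub> a = F"
        if "F \<in> hom C \<Gamma> (exp_obj C S (car I))" for \<Gamma> F
        using that by (intro alg_isoD(1)[OF iso]) (simp add: fun_alg_sel)
    qed
  qed
qed

end
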